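(* Let $G(n)=(V(n),E(n))$ be an instance of the $n$-node generalized random graph generated according to a given expected (in-)degree sequence $(d_1(n),\dots,d_n(n))$. Given the degree-dependent probability $B_v(0)$, determine the state (blue or not) of each node $v\in V(n)$ at time $0$ according to $B_v(0)$ (blue with probability $B_v(0)$), independent of anything else. Let $S\subseteq V(n)$ be the set of blue nodes in $G(n)$ at time $t=0$, and $$\phi(n)=\frac{\sum_{v\in S}\deg(v)}{\sum_{u\in V(n)}\deg(u)},$$ where $\deg(v)$ is the (in-)degree of $v\in V(n)$ in $G(n)$. Let $$s_{n,v}^2=\sum_{u\in V(n)}B_u(0)^2p_{vu}(n)(1-p_{vu}(n)),$$ $$q_{n,v}=\sum_{u\in V(n)}B_u(0)^3p_{vu}(n)(1-p_{vu}(n))\big[(1-p_{vu}(n))^2+p_{vu}(n)^2\big],$$ $$w_{n,v}^2=\sum_{u\in V(n)}p_{vu}(n)(1-p_{vu}(n)),$$ $$g_{n,v}=\sum_{u\in V(n)}p_{vu}(n)(1-p_{vu}(n))\big[(1-p_{vu}(n))^2+p_{vu}(n)^2\big].$$ Assume: (i) $\lim_{n\to\infty}\sup_{v\in V(n)}q_{n,v}/s_{n,v}^3=0$; (ii) $\lim_{n\to\infty}\sup_{v\in V(n)}g_{n,v}/w_{n,v}^3=0$; (iii) $\lim_{n\to\infty}\sqrt{\ln(n)}/d_{\min}(n)=0$; (iv) $\lim_{n\to\infty}\big(\sum_{v\in V(n)}g_{n,v}\big)\big/\big(\sum_{v\in V(n)}w_{n,v}^2\big)^{3/2}=0$; (v)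 $\lim_{n\to\infty}\big(\sum_{v\in V(n)}q_{n,v}\big)\big/\big(\sum_{v\in V(n)}s_{n,v}^2\big)^{3/2}=0$; (vi) $\lim_{n\to\infty}\sum_{v\in V(n)}\frac{1}{d_v(n)^2}=0$. Let $B_v(t)$, $v\in V(n)$, evolve from the initial values $B_v(0)$ by the Type I dynamics with threshold $\sigma\in(0,1)$ on $G(n)$, and let $R_v(t)=1-B_v(t)$. If $\liminf_{n\to\infty}\phi(n)>\sigma$ holds almost surely, then $\lim_{n\to\infty}\lim_{t\to\infty}B_v(t)=1$ holds for all $v\in V(n)$ almost surely, namely $$\lim_{n\to\infty}\mathsf P\Big(\lim_{t\to\infty}B_v(t)=1\Big)=1.$$ If $\limsup_{n\to\infty}\phi(n)<\sigma$ holds almost surely, then $\lim_{n\to\infty}\lim_{t\to\infty}B_v(t)=0$ holds for all $v\in V(n)$ almost surely, namely $$\lim_{n\to\infty}\mathsf P\Big(\lim_{t\to\infty}R_v(t)=1\Big)=1.$$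
   Context: Generalized random graph: given $(d_1(n),\dots,d_n(n))$, each pair of nodes $(u,v)$ of $V(n)=\{1,\dots,n\}$ is linked, independently of the others, with probability $p_{vu}(n)=d_u(n)d_v(n)/\sum_{k=1}^n d_k(n)$, under the assumption $(d_{\max}(n))^2\le\sum_{k=1}^n d_k(n)$; self-links are allowed. Here $d_{\min}(n)=\min_{1\le j\le n}d_j(n)$ and $d_{\max}(n)=\max_{1\le j\le n}d_j(n)$. Further, $N_v=\{u\in V(n):(u,v)\in E(n)\}$ and $\deg(v)=|N_v|$. "Degree-dependent" refers to the setting of a strategic defender, in which the initial probability that a node is blue is proportional to its degree: $B_v(0)\propto\deg(v)$. $B_v(t)$ and $R_v(t)=1-B_v(t)$ are the probabilities that node $v$ is blue (secure), respectively red (compromised), at time $t$. The Type I dynamics with threshold $\sigma$ on $G(n)$ is the system $$\frac{d}{dt}B_v(t)=f\Big(\frac{1}{\deg(v)}\sum_{u\in N_v}B_u(t)\Big)-B_v(t),\quad v\in V(n),\qquad f(x)=\begin{cases}1&x>\sigma\\ 0&x<\sigma\\ 1/2&x=\sigma.\end{cases}$$ *)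

theory Defs
  imports "HOL-Probability.Probability"
begin

definition V :: "nat \<Rightarrow> nat set" where
  "V n = {1..n}"

text \<open>An edge set \<open>E\<close> contains \<open>(u, v)\<close> iff \<open>u\<close> is an in-neighbour of \<open>v\<close>; an undirected graph
  is represented by a symmetric edge set.\<close>

definition nbrs :: "(nat \<times> nat) set \<Rightarrow> nat \<Rightarrow> nat set" where
  "nbrs E v = {u. (u, v) \<in> E}"

definition deg :: "(nat \<times> nat) set \<Rightarrow> nat \<Rightarrow> nat" where
  "deg E v = card (nbrs E v)"

definition d_min :: "(nat \<Rightarrow> nat \<Rightarrow> real) \<Rightarrow> nat \<Rightarrow> real" where
  "d_min d n = Min (d n ` V n)"

definition d_max :: "(nat \<Rightarrow> nat \<Rightarrow> real) \<Rightarrow> nat \<Rightarrow> real" where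
  "d_max d n = Max (d n ` V n)"

definition link_prob :: "(nat \<Rightarrow> nat \<Rightarrow> real) \<Rightarrow> nat \<Rightarrow> nat \<Rightarrow> nat \<Rightarrow> real" where
  "link_prob d n v u = d n u * d n v / (\<Sum>k\<in>V n. d n k)"

definition directed_grg :: "(nat \<Rightarrow> nat \<Rightarrow> real) \<Rightarrow> nat \<Rightarrow> (nat \<times> nat) set pmf" where
  "directed_grg d n =
     map_pmf (\<lambda>X. {(u, v). u \<in> V n \<and> v \<in> V n \<and> X (u, v)})
       (Pi_pmf (V n \<times> V n) False (\<lambda>(u, v). bernoulli_pmf (link_prob d n v u)))"

text \<open>One coin per unordered pair (possibly a self-link), indexed by its ordered representative.\<close>

definition undirected_grg :: "(nat \<Rightarrow> nat \<Rightarrow> real) \<Rightarrow> nat \<Rightarrow> (nat \<times> nat) set pmf" where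
  "undirected_grg d n =
     map_pmf (\<lambda>X. {(u, v). u \<in> V n \<and> v \<in> V n \<and> X (min u v, max u v)})
       (Pi_pmf {(u, v). u \<in> V n \<and> v \<in> V n \<and> u \<le> v} False
          (\<lambda>(u, v). bernoulli_pmf (link_prob d n v u)))"

text \<open>Degree-dependent initial probability \<open>B\<^sub>v(0)\<close>. The proportionality factor may
  depend on the realised graph, since any normalisation, e.g. by the maximal degree, does.\<close>

definition init_blue ::
  "(nat \<Rightarrow> (nat \<times> nat) set \<Rightarrow> real) \<Rightarrow> nat \<Rightarrow> (nat \<times> nat) set \<Rightarrow> nat \<Rightarrow> real" where
  "init_blue c n E v = c n E * real (deg E v)"

text \<open>Joint law of the graph and of the set of initially blue nodes: conditionally on the graph \<open>E\<close>,
  the nodes are blue independently, node \<open>v\<close> with probability \<open>b E v\<close>.\<close>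

definition graph_blue_law ::
  "(nat \<times> nat) set pmf \<Rightarrow> nat \<Rightarrow> ((nat \<times> nat) set \<Rightarrow> nat \<Rightarrow> real) \<Rightarrow>
     ((nat \<times> nat) set \<times> nat set) pmf" where
  "graph_blue_law g n b =
     bind_pmf g (\<lambda>E. map_pmf (\<lambda>X. (E, {v \<in> V n. X v}))
       (Pi_pmf (V n) False (\<lambda>v. bernoulli_pmf (b E v))))"

definition phi :: "nat \<Rightarrow> (nat \<times> nat) set \<Rightarrow> nat set \<Rightarrow> real" where
  "phi n E S = real (\<Sum>v\<in>S. deg E v) / real (\<Sum>u\<in>V n. deg E u)"

definition s :: "(nat \<Rightarrow> nat \<Rightarrow> real) \<Rightarrow> nat \<Rightarrow> (nat \<Rightarrow> real) \<Rightarrow> nat \<Rightarrow> real" where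
  "s d n b v = sqrt (\<Sum>u\<in>V n. (b u)^2 * link_prob d n v u * (1 - link_prob d n v u))"

definition q :: "(nat \<Rightarrow> nat \<Rightarrow> real) \<Rightarrow> nat \<Rightarrow> (nat \<Rightarrow> real) \<Rightarrow> nat \<Rightarrow> real" where
  "q d n b v = (\<Sum>u\<in>V n. (b u)^3 * link_prob d n v u * (1 - link_prob d n v u)
                  * ((1 - link_prob d n v u)^2 + (link_prob d n v u)^2))"

definition w :: "(nat \<Rightarrow> nat \<Rightarrow> real) \<Rightarrow> nat \<Rightarrow> nat \<Rightarrow> real" where
  "w d n v = sqrt (\<Sum>u\<in>V n. link_prob d n v u * (1 - link_prob d n v u))"

definition g :: "(nat \<Rightarrow> nat \<Rightarrow> real) \<Rightarrow> nat \<Rightarrow> nat \<Rightarrow> real" where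
  "g d n v = (\<Sum>u\<in>V n. link_prob d n v u * (1 - link_prob d n v u)
                * ((1 - link_prob d n v u)^2 + (link_prob d n v u)^2))"

definition threshold :: "real \<Rightarrow> real \<Rightarrow> real" where
  "threshold \<sigma> x = (if x > \<sigma> then 1 else if x < \<sigma> then 0 else 1/2)"

text \<open>Solutions on \<open>[0, \<infinity>)\<close> of the Type I dynamics. The right-hand side is discontinuous, so the
  derivative of a solution may fail to exist at switching times; solutions are therefore continuous
  functions that satisfy the equation outside a countable set \<open>T\<close> of times. Solutions that satisfy it
  at every time are the case \<open>T = {}\<close>.\<close>

definition type1_solution ::
  "real \<Rightarrow> nat \<Rightarrow> (nat \<times> nat) set \<Rightarrow> (nat \<Rightarrow> real) \<Rightarrow> (nat \<Rightarrow> real \<Rightarrow> real) \<Rightarrow> bool" where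
  "type1_solution \<sigma> n E b B \<longleftrightarrow>
     (\<forall>v\<in>V n. B v 0 = b v \<and> continuous_on {0..} (B v)) \<and>
     (\<exists>T. countable T \<and>
       (\<forall>v\<in>V n. \<forall>t\<in>{0..} - T.
          (B v has_real_derivative
             threshold \<sigma> ((1 / real (deg E v)) * (\<Sum>u\<in>nbrs E v. B u t)) - B v t)
          (at t within {0..})))"

end

theory Submission
  imports Defs
begin

text \<open>The initial probabilities are proportional to the degrees, so both the initial neighbourhood
  average at a node and \<open>\<phi>\<close> concentrate at \<open>c * \<Sum>d\<^sup>2 / \<Sum>d\<close>. As every initial probability is at most \<open>1\<close>,
  the factor \<open>c\<close> is at most of order \<open>1 / d_max\<close>, so \<open>c\<close> times a neighbourhood sum of expected
  degrees behaves like a sum of independent variables in \<open>[0, 1]\<close> with variance at most \<open>d_v\<close>, and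
  a Chernoff bound gives failure probabilities of order \<open>1 / d_v\<^sup>2\<close>, whose sum over \<open>v\<close> tends to \<open>0\<close>.
  Hence, with high probability, all neighbourhood averages start on the same side of the threshold
  as \<open>\<phi>\<close>. The dynamics then relaxes every node exponentially towards the corresponding state and
  never moves an average across the threshold.\<close>

section \<open>The threshold dynamics\<close>

text \<open>Zygmund's argument: the exceptional values \<open>f ` T\<close> are countable, so a descent of \<open>f\<close> would
  cross a level outside \<open>f ` T\<close>; at the last crossing the derivative cannot be positive.\<close>

lemma increasing_if_deriv_pos_except_countable:
  fixes f :: "real \<Rightarrow> real"
  assumes "a \<le> b" and cont: "continuous_on {a..b} f" and "countable T"
    and deriv: "\<And>x. x \<in> {a..<b} - T \<Longrightarrow>
      \<exists>D>0. (f has_real_derivative D) (at x within {a..b})"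
  shows "f a \<le> f b"
proof (rule ccontr)
  assume "\<not> f a \<le> f b"
  hence lt: "f b < f a" by simp
  have "countable (f ` T)" using \<open>countable T\<close> by simp
  moreover have "uncountable {f b<..<f a}" using lt by (simp add: uncountable_open_interval)
  ultimately have "uncountable ({f b<..<f a} - f ` T)" by (rule uncountable_minus_countable[rotated])
  then obtain y where "y \<in> {f b<..<f a} - f ` T"
    by (metis countable_empty ex_in_conv)
  hence y: "f b < y" "y < f a" "y \<notin> f ` T" by simp_all
  define C where "C = {x \<in> {a..b}. f x = y}"
  have "compact C"
  proof -
    have "closed C" unfolding C_def
      by (rule continuous_closed_preimage_constant[OF cont]) simp
    moreover have "bounded C" unfolding C_def
      by (rule bounded_subset[of "{a..b}"]) auto
    ultimately show ?thesis by (simp add: compact_eq_bounded_closed)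
  qed
  moreover have "C \<noteq> {}"
    using IVT2'[of f b y a] y \<open>a \<le> b\<close> cont unfolding C_def by auto
  ultimately obtain s where s: "s \<in> C" "\<And>x. x \<in> C \<Longrightarrow> x \<le> s"
    using compact_attains_sup[of C] by auto
  have sab: "s \<in> {a..<b}" "f s = y" "s \<notin> T"
    using s y unfolding C_def by (auto simp: order_le_less)
  then obtain D where "D > 0" "(f has_real_derivative D) (at s within {a..b})"
    using deriv by blast
  then obtain e where e: "e > 0" "\<And>h. 0 < h \<Longrightarrow> s + h \<in> {a..b} \<Longrightarrow> h < e \<Longrightarrow> f s < f (s + h)"
    using has_real_derivative_pos_inc_right[of f D s "{a..b}"] by blast
  define h where "h = min (e/2) ((b - s)/2)"
  have "0 < h" "h < e" "h \<le> (b - s)/2"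
    using e(1) sab(1) unfolding h_def by (simp_all del: le_divide_eq_numeral1)
  hence h: "0 < h" "h < e" "s + h \<in> {a..b}" "s + h < b" using sab(1) by auto
  have "y < f (s + h)" using e(2)[of h] h sab by simp
  then obtain x where "x \<in> {s+h..b}" "f x = y"
    using IVT2'[of f b y "s+h"] y h continuous_on_subset[OF cont, of "{s+h..b}"] by auto
  hence "x \<in> C" "x > s" using h unfolding C_def by auto
  with s(2) show False by fastforce
qed

text \<open>Adding \<open>e * x\<close> with \<open>e > 0\<close> tilts a zero derivative to a
  positive one, so the monotonicity lemma applies to both \<open>f\<close> and \<open>- f\<close>;
  letting \<open>e\<close> tend to 0 removes the tilt.\<close>

lemma constant_if_deriv_zero_except_countable:
  fixes f :: "real \<Rightarrow> real"
  assumes "a \<le> b" and cont: "continuous_on {a..b} f" and "countable T"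
    and deriv: "\<And>x. x \<in> {a..<b} - T \<Longrightarrow> (f has_real_derivative 0) (at x within {a..b})"
  shows "f b = f a"
proof -
  have mono: "h a \<le> h b + e * (b - a)"
    if "e > 0" and "continuous_on {a..b} h"
      and "\<And>x. x \<in> {a..<b} - T \<Longrightarrow> (h has_real_derivative 0) (at x within {a..b})"
    for h :: "real \<Rightarrow> real" and e
  proof -
    have "(\<lambda>x. h x + e * x) a \<le> (\<lambda>x. h x + e * x) b"
    proof (rule increasing_if_deriv_pos_except_countable[OF \<open>a \<le> b\<close> _ \<open>countable T\<close>])
      show "continuous_on {a..b} (\<lambda>x. h x + e * x)" by (intro continuous_intros that)
      fix x assume "x \<in> {a..<b} - T"
      from that(3)[OF this] have "((\<lambda>x. h x + e * x) has_real_derivative e) (at x within {a..b})"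
        by (auto intro!: derivative_eq_intros)
      with \<open>e > 0\<close> show "\<exists>D>0. ((\<lambda>x. h x + e * x) has_real_derivative D) (at x within {a..b})"
        by blast
    qed
    thus ?thesis by (simp add: algebra_simps)
  qed
  have small: "h a \<le> h b"
    if "\<And>e. e > 0 \<Longrightarrow> h a \<le> h b + e * (b - a)" for h :: "real \<Rightarrow> real"
  proof (cases "a = b")
    case False
    hence "b - a > 0" using \<open>a \<le> b\<close> by simp
    show ?thesis
    proof (rule field_le_epsilon)
      fix e :: real assume "e > 0"
      with that[of "e / (b - a)"] \<open>b - a > 0\<close> show "h a \<le> h b + e" by simp
    qed
  qed simp
  have "f a \<le> f b" using mono[of _ f] cont deriv by (intro small) auto
  moreover have "- f a \<le> - f b"
  proof (rule small[of "\<lambda>x. - f x"], rule mono[of _ "\<lambda>x. - f x"])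
    show "continuous_on {a..b} (\<lambda>x. - f x)" by (intro continuous_intros cont)
    show "((\<lambda>x. - f x) has_real_derivative 0) (at x within {a..b})" if "x \<in> {a..<b} - T" for x
      using DERIV_minus[OF deriv[OF that]] by simp
  qed
  ultimately show ?thesis by simp
qed

text \<open>\<open>Q\<close> abstracts one side of the threshold, so that both cases share one
  argument: the open half-line above \<sigma> with \<rho> = 1, or the one below with \<rho> = 0.
  \<open>starQ\<close> says that moving from a point of \<open>Q\<close> towards \<rho> never leaves
  \<open>Q\<close>.\<close>

context
  fixes \<sigma> \<rho> :: real and Q :: "real set" and n :: nat and E :: "(nat \<times> nat) set" and b :: "nat \<Rightarrow> real"
  assumes openQ: "open Q"
    and thrQ: "\<And>x. x \<in> Q \<Longrightarrow> threshold \<sigma> x = \<rho>"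
    and starQ: "\<And>x \<theta>. x \<in> Q \<Longrightarrow> 0 < \<theta> \<Longrightarrow> \<theta> \<le> 1 \<Longrightarrow> \<rho> + (x - \<rho>) * \<theta> \<in> Q"
    and nbrsV: "\<And>v. v \<in> V n \<Longrightarrow> nbrs E v \<subseteq> V n"
    and degpos: "\<And>v. v \<in> V n \<Longrightarrow> deg E v > 0"
    and initQ: "\<And>v. v \<in> V n \<Longrightarrow> (1 / real (deg E v)) * (\<Sum>u\<in>nbrs E v. b u) \<in> Q"
begin

text \<open>Averaging is affine and its weights sum to 1, so the average of the relaxed values is
  the relaxation of the initial average; \<open>starQ\<close> with \<theta> =
  \<open>exp (-t)\<close> keeps it in \<open>Q\<close>.\<close>

lemma nbr_average_relaxation:
  assumes v: "v \<in> V n" and "t \<ge> 0"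
    and B: "\<And>u. u \<in> V n \<Longrightarrow> B u = \<rho> + (b u - \<rho>) * exp (-t)"
  shows "(1 / real (deg E v)) * (\<Sum>u\<in>nbrs E v. B u) \<in> Q"
proof -
  have "(\<Sum>u\<in>nbrs E v. B u) = (\<Sum>u\<in>nbrs E v. \<rho> + (b u - \<rho>) * exp (-t))"
    using nbrsV[OF v] by (intro sum.cong) (auto simp: B)
  also have "\<dots> = real (deg E v) * \<rho> + ((\<Sum>u\<in>nbrs E v. b u) - real (deg E v) * \<rho>) * exp (-t)"
    by (simp add: sum.distrib sum_subtractf deg_def flip: sum_distrib_right)
  finally have "(1 / real (deg E v)) * (\<Sum>u\<in>nbrs E v. B u)
      = \<rho> + ((1 / real (deg E v)) * (\<Sum>u\<in>nbrs E v. b u) - \<rho>) * exp (-t)"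
    using degpos[OF v] by (simp add: field_simps)
  thus ?thesis using starQ[OF initQ[OF v], of "exp (-t)"] \<open>t \<ge> 0\<close> by simp
qed

text \<open>All averages stay in \<open>Q\<close>, where the right-hand side is \<rho> minus the
  current value, so the exponential solves the equation at every time. This existence keeps the
  later claim about all solutions from being vacuous.\<close>

lemma relaxation_is_solution:
  "type1_solution \<sigma> n E b (\<lambda>v t. \<rho> + (b v - \<rho>) * exp (-t))"
  unfolding type1_solution_def
proof (intro conjI ballI exI[of _ "{}"])
  fix v t assume v: "v \<in> V n" and "t \<in> {0::real..} - {}"
  hence "threshold \<sigma> (1 / real (deg E v) * (\<Sum>u\<in>nbrs E v. \<rho> + (b u - \<rho>) * exp (-t))) = \<rho>"
    by (intro thrQ nbr_average_relaxation[of v t]) auto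
  thus "((\<lambda>t. \<rho> + (b v - \<rho>) * exp (-t)) has_real_derivative
      threshold \<sigma> (1 / real (deg E v) * (\<Sum>u\<in>nbrs E v. \<rho> + (b u - \<rho>) * exp (-t)))
        - (\<rho> + (b v - \<rho>) * exp (-t))) (at t within {0..})"
    by (auto intro!: derivative_eq_intros)
qed (auto intro!: continuous_intros)

text \<open>Until the first time at which some neighbourhood average leaves \<open>Q\<close>, the solution is the
  explicit relaxation towards \<open>\<rho>\<close>, along which the averages stay in the open set \<open>Q\<close>.\<close>

lemma solution_is_relaxation:
  assumes sol: "type1_solution \<sigma> n E b B" and v: "v \<in> V n" and t: "t \<ge> 0"
  shows "B v t = \<rho> + (b v - \<rho>) * exp (-t)"
proof -
  define A where "A = (\<lambda>v t. (1 / real (deg E v)) * (\<Sum>u\<in>nbrs E v. B u t))"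
  from sol obtain T where T: "countable T"
    and B0: "\<And>v. v \<in> V n \<Longrightarrow> B v 0 = b v"
    and contB: "\<And>v. v \<in> V n \<Longrightarrow> continuous_on {0..} (B v)"
    and dB: "\<And>v t. v \<in> V n \<Longrightarrow> t \<in> {0..} - T \<Longrightarrow>
        (B v has_real_derivative threshold \<sigma> (A v t) - B v t) (at t within {0..})"
    unfolding type1_solution_def A_def by blast
  \<comment> \<open>Integrating factor: \<open>(B v t - \<rho>) * exp t\<close> has derivative zero
    outside \<open>T\<close>. Averages are required in \<open>Q\<close> only strictly before \<tau>,
    so the formula also holds at a first exit time itself.\<close>
  have explicit: "B v \<tau> = \<rho> + (b v - \<rho>) * exp (-\<tau>)"
    if \<tau>: "\<tau> \<ge> 0" and inQ: "\<And>v t. v \<in> V n \<Longrightarrow> 0 \<le> t \<Longrightarrow> t < \<tau> \<Longrightarrow> A v t \<in> Q" and v: "v \<in> V n"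
    for v \<tau>
  proof -
    define h where "h = (\<lambda>t. (B v t - \<rho>) * exp t)"
    have "h \<tau> = h 0"
    proof (rule constant_if_deriv_zero_except_countable[OF \<tau> _ T])
      show "continuous_on {0..\<tau>} h" unfolding h_def
        by (intro continuous_intros continuous_on_subset[OF contB[OF v]]) auto
      fix t assume t: "t \<in> {0..<\<tau>} - T"
      have "threshold \<sigma> (A v t) = \<rho>" using inQ[OF v] t by (intro thrQ) auto
      with dB[OF v, of t] t have "(B v has_real_derivative \<rho> - B v t) (at t within {0..\<tau>})"
        by (auto intro: has_field_derivative_subset)
      thus "(h has_real_derivative 0) (at t within {0..\<tau>})" unfolding h_def
        by (auto intro!: derivative_eq_intros simp: algebra_simps)
    qed
    thus ?thesis using B0[OF v] unfolding h_def by (simp add: exp_minus field_simps)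
  qed
  have inQ: "A v t \<in> Q" if "v \<in> V n" "t \<ge> 0" for v t
  proof (rule ccontr)
    assume bad: "A v t \<notin> Q"
    \<comment> \<open>\<open>Z\<close> collects the exit times. It is closed because
      \<open>Q\<close> is open and the averages are continuous, so a first exit time is attained;
      the explicit formula there puts the average back into \<open>Q\<close>.\<close>
    define Z where "Z = (\<Union>v\<in>V n. {t \<in> {0..}. A v t \<in> - Q})"
    have "closed Z" unfolding Z_def
    proof (intro closed_UN ballI)
      fix v assume v: "v \<in> V n"
      have "continuous_on {0..} (A v)" unfolding A_def
        using nbrsV[OF v] by (intro continuous_intros contB) auto
      thus "closed {t \<in> {0..}. A v t \<in> - Q}"
        using continuous_closed_preimage[of "{0..}" "A v" "- Q"] openQ
        by (simp add: vimage_def Int_def closed_Compl)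
    qed (simp add: V_def)
    moreover have ne: "Z \<noteq> {}" and bdd: "bdd_below Z"
      using bad that unfolding Z_def by (auto intro!: bdd_belowI[of _ 0])
    ultimately have "Inf Z \<in> Z" using closed_contains_Inf by blast
    then obtain u where u: "u \<in> V n" "Inf Z \<ge> 0" "A u (Inf Z) \<notin> Q" unfolding Z_def by auto
    have before: "A v t \<in> Q" if "v \<in> V n" "0 \<le> t" "t < Inf Z" for v t
    proof (rule ccontr)
      assume "A v t \<notin> Q"
      hence "t \<in> Z" using that unfolding Z_def by auto
      thus False using cInf_lower[OF _ bdd] that by fastforce
    qed
    have "A u (Inf Z) \<in> Q" unfolding A_def
      by (intro nbr_average_relaxation[OF u(1,2)] explicit[OF u(2) before]) auto
    with u show False by simp
  qed
  show ?thesis by (intro explicit[OF t _ v] inQ) auto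
qed

lemma all_solutions_converge:
  "(\<exists>B. type1_solution \<sigma> n E b B) \<and>
   (\<forall>B. type1_solution \<sigma> n E b B \<longrightarrow> (\<forall>v\<in>V n. (B v \<longlongrightarrow> \<rho>) at_top))"
proof (intro conjI allI impI ballI)
  show "\<exists>B. type1_solution \<sigma> n E b B" using relaxation_is_solution by blast
next
  fix B v assume sol: "type1_solution \<sigma> n E b B" and v: "v \<in> V n"
  have "((\<lambda>t. exp (-t) :: real) \<longlongrightarrow> 0) at_top"
    by (rule filterlim_compose[OF exp_at_bot filterlim_uminus_at_bot_at_top])
  hence "((\<lambda>t. \<rho> + (b v - \<rho>) * exp (-t)) \<longlongrightarrow> \<rho> + (b v - \<rho>) * 0) at_top"
    by (intro tendsto_intros)
  moreover have "\<forall>\<^sub>F t in at_top. B v t = \<rho> + (b v - \<rho>) * exp (-t)"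
    using eventually_ge_at_top[of 0] by (rule eventually_mono) (rule solution_is_relaxation[OF sol v])
  ultimately show "(B v \<longlongrightarrow> \<rho>) at_top"
    using tendsto_cong by fastforce
qed

end

section \<open>Weighted sums of independent coins\<close>

text \<open>For negative \<open>x = - y\<close> the claim is
  \<open>1 \<le> (1 - y + y^2) * exp y\<close>. Replacing \<open>exp y\<close> by its quadratic
  Taylor polynomial leaves a product that is 1 plus nonnegative terms.\<close>

lemma exp_le_quadratic:
  fixes x :: real
  assumes "\<bar>x\<bar> \<le> 1"
  shows "exp x \<le> 1 + x + x\<^sup>2"
proof (cases "x \<ge> 0")
  case True
  thus ?thesis using exp_bound[of x] assms by simp
next
  case False
  define y where "y = - x"
  have y: "0 \<le> y" using False unfolding y_def by simp
  have "1 \<le> 1 + y\<^sup>2/2 + y^3/2 + y^4/2" using y by simp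
  also have "\<dots> = (1 - y + y\<^sup>2) * (1 + y + y\<^sup>2/2)" 
    by (simp add: field_simps power2_eq_square power3_eq_cube power4_eq_xxxx)
  also have "\<dots> \<le> (1 - y + y\<^sup>2) * exp y"
  proof (rule mult_left_mono[OF exp_lower_Taylor_quadratic[OF y]])
    show "0 \<le> 1 - y + y\<^sup>2" using assms unfolding y_def by simp
  qed
  finally show ?thesis unfolding y_def by (simp add: exp_minus field_simps)
qed

text \<open>Trades an exponential tail for an inverse square, the form in which the hypothesis on
  the sum of \<open>1 / (d n v)^2\<close> can absorb it.\<close>

lemma exp_minus_le_inverse_square:
  fixes x :: real
  assumes "x > 0"
  shows "exp (- x) \<le> 2 / x\<^sup>2"
proof -
  have "x\<^sup>2 / 2 \<le> exp x" using exp_lower_Taylor_quadratic[of x] assms by simp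
  thus ?thesis using assms by (simp add: exp_minus field_simps)
qed

text \<open>The bound \<open>1 + z \<le> exp z\<close> with \<open>z = p * (exp y - 1)\<close>, then
  the quadratic bound on \<open>exp y\<close>: the linear terms cancel. The factor \<open>p\<close>
  survives in the exponent, so sparse coins contribute little.\<close>

lemma bernoulli_centred_mgf_le:
  fixes p y :: real
  assumes "0 \<le> p" "p \<le> 1" "\<bar>y\<bar> \<le> 1"
  shows "measure_pmf.expectation (bernoulli_pmf p) (\<lambda>x. exp (y * (of_bool x - p))) \<le> exp (y\<^sup>2 * p)"
proof -
  have "measure_pmf.expectation (bernoulli_pmf p) (\<lambda>x. exp (y * (of_bool x - p)))
      = exp (- y * p) * (1 + p * (exp y - 1))"
    using assms by (simp add: algebra_simps flip: exp_add)
  also have "\<dots> \<le> exp (- y * p) * exp (p * (exp y - 1))"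
    by (intro mult_left_mono) auto
  also have "\<dots> = exp (- y * p + p * (exp y - 1))" by (rule exp_add[symmetric])
  also have "\<dots> \<le> exp (- y * p + p * (y + y\<^sup>2))"
    using exp_le_quadratic[of y] assms by (intro iffD2[OF exp_le_cancel_iff] add_left_mono mult_left_mono) auto
  also have "\<dots> = exp (y\<^sup>2 * p)" by (simp add: algebra_simps)
  finally show ?thesis .
qed

context
  fixes A :: "'a set" and p a :: "'a \<Rightarrow> real" and T \<epsilon> :: real
  assumes finA: "finite A"
    and p: "\<And>u. u \<in> A \<Longrightarrow> 0 \<le> p u \<and> p u \<le> 1"
    and a: "\<And>u. u \<in> A \<Longrightarrow> \<bar>a u\<bar> \<le> 1"
    and T: "(\<Sum>u\<in>A. (a u)\<^sup>2 * p u) \<le> T"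
    and eps: "0 < \<epsilon>" "\<epsilon> \<le> 2"
begin

lemma weighted_bernoulli_upper_tail:
  "measure_pmf.prob (Pi_pmf A False (\<lambda>u. bernoulli_pmf (p u)))
     {X. \<epsilon> * T \<le> (\<Sum>u\<in>A. a u * of_bool (X u)) - (\<Sum>u\<in>A. a u * p u)} \<le> exp (- (\<epsilon>\<^sup>2 * T / 4))"
proof -
  let ?P = "Pi_pmf A False (\<lambda>u. bernoulli_pmf (p u))"
  \<comment> \<open>The exponent \<open>t^2 * T - t * \<epsilon> * T\<close> is minimal at this
    \<open>t\<close>, with value \<open>- \<epsilon>^2 * T / 4\<close>. The bound \<epsilon> \<le> 2
    gives \<open>t \<le> 1\<close>, hence \<open>\<bar>t * a u\<bar> \<le> 1\<close> as the moment
    bound requires.\<close>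
  define t where "t = \<epsilon> / 2"
  have t: "0 < t" "t \<le> 1" using eps unfolding t_def by auto
  define F where "F = (\<lambda>X. \<Prod>u\<in>A. exp (t * a u * (of_bool (X u) - p u)))"
  have F: "F X = exp (t * ((\<Sum>u\<in>A. a u * of_bool (X u)) - (\<Sum>u\<in>A. a u * p u)))" for X
  proof -
    have "(\<Sum>u\<in>A. t * a u * (of_bool (X u) - p u))
        = t * ((\<Sum>u\<in>A. a u * of_bool (X u)) - (\<Sum>u\<in>A. a u * p u))"
      unfolding sum_subtractf[symmetric] sum_distrib_left by (intro sum.cong) (auto simp: algebra_simps)
    thus ?thesis unfolding F_def by (simp only: exp_sum[OF finA, symmetric])
  qed
  have fin: "finite (set_pmf ?P)"
    using finA by (simp add: set_Pi_pmf finite_PiE_dflt)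
  have "measure_pmf.expectation ?P F
      = (\<Prod>u\<in>A. measure_pmf.expectation (bernoulli_pmf (p u)) (\<lambda>x. exp (t * a u * (of_bool x - p u))))"
    unfolding F_def
    by (rule expectation_prod_Pi_pmf) (auto intro: integrable_measure_pmf_finite finA)
  also have "\<dots> \<le> (\<Prod>u\<in>A. exp ((t * a u)\<^sup>2 * p u))"
  proof (intro prod_mono conjI)
    fix u assume u: "u \<in> A"
    have "\<bar>t * a u\<bar> \<le> 1 * 1" unfolding abs_mult
      using t a[OF u] by (intro mult_mono) auto
    thus "measure_pmf.expectation (bernoulli_pmf (p u)) (\<lambda>x. exp (t * a u * (of_bool x - p u)))
        \<le> exp ((t * a u)\<^sup>2 * p u)"
      using p[OF u] by (intro bernoulli_centred_mgf_le) auto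
  qed (auto intro!: integral_nonneg_AE)
  also have "\<dots> = exp (t\<^sup>2 * (\<Sum>u\<in>A. (a u)\<^sup>2 * p u))"
    by (simp add: finA sum_distrib_left power_mult_distrib mult.assoc flip: exp_sum)
  also have "\<dots> \<le> exp (t\<^sup>2 * T)" using T by (simp add: mult_left_mono)
  finally have EF: "measure_pmf.expectation ?P F \<le> exp (t\<^sup>2 * T)" .
  have "{X. \<epsilon> * T \<le> (\<Sum>u\<in>A. a u * of_bool (X u)) - (\<Sum>u\<in>A. a u * p u)}
      = {X \<in> space (measure_pmf ?P). exp (t * (\<epsilon> * T)) \<le> F X}"
    using t by (auto simp: F)
  also have "measure_pmf.prob ?P \<dots> \<le> measure_pmf.expectation ?P F / exp (t * (\<epsilon> * T))"
    by (intro integral_Markov_inequality_measure[where A = "{}"] integrable_measure_pmf_finite fin)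
       (auto simp: F)
  also have "\<dots> \<le> exp (t\<^sup>2 * T) / exp (t * (\<epsilon> * T))"
    using EF by (intro divide_right_mono) auto
  also have "\<dots> = exp (- (\<epsilon>\<^sup>2 * T / 4))"
    unfolding t_def by (simp add: power2_eq_square algebra_simps flip: exp_diff)
  finally show ?thesis .
qed

end

text \<open>The upper tail is applied to \<open>a\<close> and to \<open>- a\<close>.
  \<open>T\<close> may be any positive upper bound of the variance proxy, so a convenient scale such
  as an expected degree can be inserted.\<close>

lemma weighted_bernoulli_concentration:
  fixes A :: "'a set" and p a :: "'a \<Rightarrow> real"
  assumes "finite A" "\<And>u. u \<in> A \<Longrightarrow> 0 \<le> p u \<and> p u \<le> 1" "\<And>u. u \<in> A \<Longrightarrow> \<bar>a u\<bar> \<le> 1"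
    and "(\<Sum>u\<in>A. (a u)\<^sup>2 * p u) \<le> T" "0 < T" "0 < \<epsilon>" "\<epsilon> \<le> 2"
  shows "measure_pmf.prob (Pi_pmf A False (\<lambda>u. bernoulli_pmf (p u)))
     {X. \<epsilon> * T \<le> \<bar>(\<Sum>u\<in>A. a u * of_bool (X u)) - (\<Sum>u\<in>A. a u * p u)\<bar>} \<le> 64 / (\<epsilon>^4 * T\<^sup>2)"
proof -
  let ?P = "Pi_pmf A False (\<lambda>u. bernoulli_pmf (p u))"
  let ?U = "\<lambda>a. {X. \<epsilon> * T \<le> (\<Sum>u\<in>A. a u * of_bool (X u)) - (\<Sum>u\<in>A. a u * p u)}"
  have "measure_pmf.prob ?P {X. \<epsilon> * T \<le> \<bar>(\<Sum>u\<in>A. a u * of_bool (X u)) - (\<Sum>u\<in>A. a u * p u)\<bar>}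
      \<le> measure_pmf.prob ?P (?U a \<union> ?U (\<lambda>u. - a u))"
    by (intro measure_pmf.finite_measure_mono) (auto simp: sum_negf abs_if split: if_splits)
  also have "\<dots> \<le> measure_pmf.prob ?P (?U a) + measure_pmf.prob ?P (?U (\<lambda>u. - a u))"
    by (rule measure_subadditive) (auto simp: measure_pmf.emeasure_eq_measure)
  also have "\<dots> \<le> exp (- (\<epsilon>\<^sup>2 * T / 4)) + exp (- (\<epsilon>\<^sup>2 * T / 4))"
    using assms by (intro add_mono weighted_bernoulli_upper_tail) auto
  also have "\<dots> \<le> 2 * (2 / (\<epsilon>\<^sup>2 * T / 4)\<^sup>2)"
    using exp_minus_le_inverse_square[of "\<epsilon>\<^sup>2 * T / 4"] assms by simp
  also have "\<dots> = 64 / (\<epsilon>^4 * T\<^sup>2)"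
    by (simp add: power_mult_distrib power_divide)
  finally show ?thesis .
qed

section \<open>Marginals of product laws and columns of the random graph\<close>

lemma map_Pi_pmf_reindex:
  assumes "finite A" "finite B" "inj_on h B" "h ` B \<subseteq> A"
  shows "map_pmf (\<lambda>X u. if u \<in> B then X (h u) else dflt) (Pi_pmf A dflt p) = Pi_pmf B dflt (\<lambda>u. p (h u))"
proof (rule pmf_eqI)
  fix f
  let ?m = "\<lambda>X u. if u \<in> B then X (h u) else dflt"
  show "pmf (map_pmf ?m (Pi_pmf A dflt p)) f = pmf (Pi_pmf B dflt (\<lambda>u. p (h u))) f"
  proof (cases "\<forall>u. u \<notin> B \<longrightarrow> f u = dflt")
    case False
    hence "?m -` {f} = {}" by (auto simp: fun_eq_iff)
    hence "pmf (map_pmf ?m (Pi_pmf A dflt p)) f = 0" by (simp add: pmf_map)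
    with False assms show ?thesis by (auto simp: pmf_Pi)
  next
    case True
    let ?Y = "\<lambda>a. {y. \<forall>u\<in>B. h u = a \<longrightarrow> y = f u}"
    have "?m -` {f} = Pi A ?Y" using True assms by (fastforce simp: fun_eq_iff Pi_iff)
    hence "pmf (map_pmf ?m (Pi_pmf A dflt p)) f = (\<Prod>a\<in>A. measure_pmf.prob (p a) (?Y a))"
      using assms by (simp add: pmf_map measure_Pi_pmf_Pi)
    also have "\<dots> = (\<Prod>a\<in>h ` B. measure_pmf.prob (p a) (?Y a))"
    proof (rule prod.mono_neutral_right)
      show "\<forall>a\<in>A - h ` B. measure_pmf.prob (p a) (?Y a) = 1"
      proof
        fix a assume "a \<in> A - h ` B"
        hence "?Y a = UNIV" by auto
        thus "measure_pmf.prob (p a) (?Y a) = 1" by simp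
      qed
    qed (use assms in auto)
    also have "\<dots> = (\<Prod>u\<in>B. measure_pmf.prob (p (h u)) (?Y (h u)))"
      using assms by (simp add: prod.reindex)
    also have "\<dots> = (\<Prod>u\<in>B. pmf (p (h u)) (f u))"
    proof (rule prod.cong)
      fix u assume "u \<in> B"
      hence "?Y (h u) = {f u}" using assms by (auto dest: inj_onD)
      thus "measure_pmf.prob (p (h u)) (?Y (h u)) = pmf (p (h u)) (f u)"
        by (simp add: measure_pmf_single)
    qed simp
    finally show ?thesis using True assms by (simp add: pmf_Pi)
  qed
qed

text \<open>Total probability, with the conditional probability bounded by 1 on the bad set
  \<open>B\<close> and by \<open>K\<close> elsewhere. Here \<open>B\<close> will be the graphs with
  badly concentrated degrees.\<close>

lemma prob_bind_pmf_le:
  assumes "\<And>x. x \<in> set_pmf p \<Longrightarrow> x \<notin> B \<Longrightarrow> measure_pmf.prob (f x) A \<le> K" "0 \<le> K"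
  shows "measure_pmf.prob (bind_pmf p f) A \<le> measure_pmf.prob p B + K"
proof -
  have "ennreal (measure_pmf.prob (bind_pmf p f) A) = (\<integral>\<^sup>+x. emeasure (f x) A \<partial>p)"
    by (simp flip: measure_pmf.emeasure_eq_measure)
  also have "\<dots> \<le> (\<integral>\<^sup>+x. indicator B x + ennreal K \<partial>p)"
  proof (rule nn_integral_mono_AE, simp add: AE_measure_pmf_iff, intro ballI)
    fix x assume "x \<in> set_pmf p"
    thus "emeasure (f x) A \<le> indicator B x + ennreal K"
      using assms(1)[of x] measure_pmf.emeasure_le_1[of "f x" A]
      by (cases "x \<in> B")
         (auto simp: measure_pmf.emeasure_eq_measure intro!: ennreal_leI add_increasing2)
  qed
  also have "\<dots> = ennreal (measure_pmf.prob p B + K)"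
    using assms(2) by (simp add: nn_integral_add measure_pmf.emeasure_eq_measure)
  finally show ?thesis using assms(2) by (subst (asm) ennreal_le_iff) auto
qed

text \<open>In the undirected model different columns share coins, but within one column the
  unordered pairs are distinct and \<open>link_prob\<close> is symmetric. Each column is thus a
  family of independent coins in both models; a union bound over columns then suffices.\<close>

lemma column_law:
  assumes "G = directed_grg \<or> G = undirected_grg" and v: "v \<in> V n"
  shows "map_pmf (\<lambda>E u. (u, v) \<in> E) (G d n) = Pi_pmf (V n) False (\<lambda>u. bernoulli_pmf (link_prob d n v u))"
proof -
  have fin: "finite (V n)" unfolding V_def by simp
  from assms(1) show ?thesis
  proof
    assume G: "G = directed_grg"
    have "map_pmf (\<lambda>E u. (u, v) \<in> E) (G d n) =
        map_pmf (\<lambda>X u. if u \<in> V n then X (u, v) else False)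
          (Pi_pmf (V n \<times> V n) False (\<lambda>(u, v). bernoulli_pmf (link_prob d n v u)))"
      unfolding G directed_grg_def map_pmf_comp using v
      by (intro map_pmf_cong) auto
    also have "\<dots> = Pi_pmf (V n) False (\<lambda>u. bernoulli_pmf (link_prob d n v u))"
      using map_Pi_pmf_reindex[of "V n \<times> V n" "V n" "\<lambda>u. (u, v)" False
          "\<lambda>(u, v). bernoulli_pmf (link_prob d n v u)"] fin v
      by (simp add: inj_on_def image_subset_iff cong: if_cong)
    finally show ?thesis .
  next
    assume G: "G = undirected_grg"
    let ?A = "{(u, v). u \<in> V n \<and> v \<in> V n \<and> u \<le> v}"
    have "finite ?A" by (rule finite_subset[of _ "V n \<times> V n"]) (use fin in auto)
    moreover have "inj_on (\<lambda>u. (min u v, max u v)) (V n)"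
      by (auto simp: inj_on_def min_def max_def split: if_splits)
    moreover have "(\<lambda>u. (min u v, max u v)) ` V n \<subseteq> ?A"
      using v by (auto simp: min_def max_def)
    ultimately have "map_pmf (\<lambda>X u. if u \<in> V n then X (min u v, max u v) else False)
          (Pi_pmf ?A False (\<lambda>(u, v). bernoulli_pmf (link_prob d n v u)))
        = Pi_pmf (V n) False (\<lambda>u. bernoulli_pmf (link_prob d n (max u v) (min u v)))"
      using map_Pi_pmf_reindex[of ?A "V n" "\<lambda>u. (min u v, max u v)" False
          "\<lambda>(u, v). bernoulli_pmf (link_prob d n v u)"] fin
      by (simp cong: if_cong)
    moreover have "link_prob d n (max u v) (min u v) = link_prob d n v u" for u
      unfolding link_prob_def by (auto simp: min_def max_def mult.commute)
    moreover have "map_pmf (\<lambda>E u. (u, v) \<in> E) (G d n) =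
        map_pmf (\<lambda>X u. if u \<in> V n then X (min u v, max u v) else False)
          (Pi_pmf ?A False (\<lambda>(u, v). bernoulli_pmf (link_prob d n v u)))"
      unfolding G undirected_grg_def map_pmf_comp using v
      by (intro map_pmf_cong) auto
    ultimately show ?thesis by simp
  qed
qed

lemma nbrs_subset_V:
  assumes "G = directed_grg \<or> G = undirected_grg" and "E \<in> set_pmf (G d n)"
  shows "nbrs E v \<subseteq> V n"
  using assms by (auto simp: directed_grg_def undirected_grg_def nbrs_def)

section \<open>Degrees and neighbourhood sums of the random graph\<close>

text \<open>The size-biased mean of the expected degrees. Times \<open>d n v\<close>, it is the
  expected sum of \<open>d n u\<close> over the neighbours \<open>u\<close> of
  \<open>v\<close>.\<close>

definition mean_nbr_degree :: "(nat \<Rightarrow> nat \<Rightarrow> real) \<Rightarrow> nat \<Rightarrow> real" where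
  "mean_nbr_degree d n = (\<Sum>u\<in>V n. (d n u)\<^sup>2) / (\<Sum>u\<in>V n. d n u)"

text \<open>The second deviation is measured at scale \<open>d_max d n * d n v\<close> because the
  weights \<open>d n u / d_max d n\<close> lie in [0, 1], as the Chernoff bound demands.\<close>

definition degrees_concentrated :: "real \<Rightarrow> (nat \<Rightarrow> nat \<Rightarrow> real) \<Rightarrow> nat \<Rightarrow> (nat \<times> nat) set \<Rightarrow> bool" where
  "degrees_concentrated \<epsilon> d n E \<longleftrightarrow> (\<forall>v\<in>V n. nbrs E v \<subseteq> V n \<and>
     \<bar>real (deg E v) - d n v\<bar> < \<epsilon> * d n v \<and>
     \<bar>(\<Sum>u\<in>nbrs E v. d n u) - d n v * mean_nbr_degree d n\<bar> < \<epsilon> * d_max d n * d n v)"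

text \<open>The graph conditions are bundled in because the deterministic lemma on the dynamics
  needs them together with the closeness to \<open>phi\<close>.\<close>

definition averages_near_phi :: "real \<Rightarrow> nat \<Rightarrow> (nat \<times> nat) set \<Rightarrow> (nat \<Rightarrow> real) \<Rightarrow> nat set \<Rightarrow> bool" where
  "averages_near_phi \<delta> n E b S \<longleftrightarrow> (\<forall>v\<in>V n. nbrs E v \<subseteq> V n \<and> deg E v > 0 \<and>
     \<bar>(1 / real (deg E v)) * (\<Sum>u\<in>nbrs E v. b u) - phi n E S\<bar> < \<delta>)"

text \<open>Write \<open>N - x * z = (N - x * k) + x * (k - z)\<close>. The error is at most
  \<open>(3 + 4/3) * \<epsilon> * k\<close>, and \<open>z \<ge> 3/4 * k\<close> turns this into
  \<open>6 * \<epsilon>\<close> after division. It serves for a node (\<open>k = d n v\<close>) and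
  for the whole graph (\<open>k\<close> the sum of all expected degrees).\<close>

lemma quotient_near:
  fixes N z k x \<epsilon> :: real
  assumes "0 < \<epsilon>" "\<epsilon> \<le> 1/4" "0 < k" "0 \<le> x" "x \<le> 4/3"
    and N: "\<bar>N - x * k\<bar> \<le> 3 * \<epsilon> * k" and z: "\<bar>z - k\<bar> \<le> \<epsilon> * k"
  shows "\<bar>N / z - x\<bar> \<le> 6 * \<epsilon>"
proof -
  have "\<epsilon> * k \<le> 1/4 * k" using assms by (intro mult_right_mono) auto
  hence zk: "3/4 * k \<le> z" using z by linarith
  hence z0: "z > 0" using assms by linarith
  have "\<bar>x * (k - z)\<bar> \<le> 4/3 * (\<epsilon> * k)"
    unfolding abs_mult using assms by (intro mult_mono) auto
  moreover have "N - x * z = (N - x * k) + x * (k - z)" by (simp add: algebra_simps)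
  ultimately have "\<bar>N - x * z\<bar> \<le> 3 * \<epsilon> * k + 4/3 * (\<epsilon> * k)" using N by linarith
  also have "\<dots> \<le> 6 * \<epsilon> * (3/4 * k)" using assms by simp
  also have "\<dots> \<le> 6 * \<epsilon> * z" using zk assms by (intro mult_left_mono) auto
  finally have "\<bar>N - x * z\<bar> / z \<le> 6 * \<epsilon>" using z0 by (simp add: field_simps)
  moreover have "N / z - x = (N - x * z) / z" using z0 by (simp add: field_simps)
  ultimately show ?thesis using z0 by (simp add: abs_divide)
qed

context
  fixes d :: "nat \<Rightarrow> nat \<Rightarrow> real" and n :: nat
  assumes n: "n \<ge> 1"
    and d_pos: "\<And>v. v \<in> V n \<Longrightarrow> 0 < d n v"
    and d_max_le: "(d_max d n)\<^sup>2 \<le> (\<Sum>k\<in>V n. d n k)"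
begin

lemma finite_V: "finite (V n)" unfolding V_def by simp

lemma V_nonempty: "V n \<noteq> {}" using n unfolding V_def by simp

lemma le_d_max: "v \<in> V n \<Longrightarrow> d n v \<le> d_max d n"
  unfolding d_max_def using finite_V by (intro Max_ge) auto

lemma d_max_attained: "\<exists>v\<in>V n. d n v = d_max d n"
proof -
  have "d_max d n \<in> d n ` V n"
    unfolding d_max_def using finite_V V_nonempty by (intro Max_in) auto
  thus ?thesis by auto
qed

lemma d_max_pos: "0 < d_max d n" using d_max_attained d_pos by force

lemma sum_d_pos: "0 < (\<Sum>k\<in>V n. d n k)"
  using d_pos by (intro sum_pos finite_V V_nonempty) auto

lemma link_prob_bounds:
  assumes "u \<in> V n" "v \<in> V n"
  shows "0 \<le> link_prob d n v u \<and> link_prob d n v u \<le> 1"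
proof -
  have "d n u * d n v \<le> d_max d n * d_max d n"
    using assms d_pos[of u] d_pos[of v] d_max_pos by (intro mult_mono le_d_max) auto
  also have "\<dots> \<le> (\<Sum>k\<in>V n. d n k)" using d_max_le by (simp add: power2_eq_square)
  finally show ?thesis
    using assms d_pos[of u] d_pos[of v] sum_d_pos unfolding link_prob_def by auto
qed

text \<open>Since self-links are allowed, the sum runs over all of \<open>V n\<close> and cancels
  the normalisation exactly.\<close>

lemma sum_link_prob: "(\<Sum>u\<in>V n. link_prob d n v u) = d n v"
  using sum_d_pos unfolding link_prob_def
  by (simp flip: sum_divide_distrib sum_distrib_right)

lemma sum_degree_link_prob: "(\<Sum>u\<in>V n. d n u * link_prob d n v u) = d n v * mean_nbr_degree d n"
  unfolding link_prob_def mean_nbr_degree_def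
  by (simp add: sum_distrib_left sum_divide_distrib power2_eq_square mult_ac)

lemma mean_nbr_degree_bounds: "0 \<le> mean_nbr_degree d n" "mean_nbr_degree d n \<le> d_max d n"
proof -
  have "(\<Sum>u\<in>V n. (d n u)\<^sup>2) \<le> (\<Sum>u\<in>V n. d_max d n * d n u)"
    using d_pos le_d_max unfolding power2_eq_square by (intro sum_mono mult_right_mono) (auto simp: less_imp_le)
  thus "mean_nbr_degree d n \<le> d_max d n"
    using sum_d_pos unfolding mean_nbr_degree_def by (simp add: sum_distrib_left[symmetric] field_simps)
  show "0 \<le> mean_nbr_degree d n"
    using sum_d_pos unfolding mean_nbr_degree_def by simp (intro divide_nonneg_pos sum_nonneg, auto)
qed

text \<open>With weights in [-1, 1] the variance proxy is at most the sum of the link probabilities,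
  which is \<open>d n v\<close>; this is the \<open>T\<close> of the tail bound.\<close>

lemma column_concentration:
  assumes G: "G = directed_grg \<or> G = undirected_grg" and v: "v \<in> V n"
    and a: "\<And>u. u \<in> V n \<Longrightarrow> \<bar>a u\<bar> \<le> 1" and eps: "0 < \<epsilon>" "\<epsilon> \<le> 2"
  shows "measure_pmf.prob (G d n)
     {E. \<epsilon> * d n v \<le> \<bar>(\<Sum>u\<in>V n. a u * of_bool ((u, v) \<in> E)) - (\<Sum>u\<in>V n. a u * link_prob d n v u)\<bar>}
     \<le> 64 / (\<epsilon>^4 * (d n v)\<^sup>2)"
proof -
  let ?X = "{X. \<epsilon> * d n v \<le> \<bar>(\<Sum>u\<in>V n. a u * of_bool (X u)) - (\<Sum>u\<in>V n. a u * link_prob d n v u)\<bar>}"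
  have "(\<Sum>u\<in>V n. (a u)\<^sup>2 * link_prob d n v u) \<le> (\<Sum>u\<in>V n. 1 * link_prob d n v u)"
  proof (intro sum_mono mult_right_mono)
    show "(a u)\<^sup>2 \<le> 1" if "u \<in> V n" for u using a[OF that] abs_square_le_1 by blast
  qed (use link_prob_bounds v in auto)
  hence "measure_pmf.prob (Pi_pmf (V n) False (\<lambda>u. bernoulli_pmf (link_prob d n v u))) ?X
      \<le> 64 / (\<epsilon>^4 * (d n v)\<^sup>2)"
    using link_prob_bounds v a eps d_pos
    by (intro weighted_bernoulli_concentration finite_V) (auto simp: sum_link_prob)
  thus ?thesis unfolding column_law[OF G v, of d, symmetric] by simp
qed

lemma sum_nbrs_eq:
  fixes a :: "nat \<Rightarrow> real"
  assumes "nbrs E v \<subseteq> V n"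
  shows "(\<Sum>u\<in>nbrs E v. a u) = (\<Sum>u\<in>V n. a u * of_bool ((u, v) \<in> E))"
proof -
  have "nbrs E v = V n \<inter> {u. (u, v) \<in> E}" using assms unfolding nbrs_def by auto
  thus ?thesis using finite_V by (simp add: sum.inter_restrict of_bool_def if_distrib cong: if_cong)
qed

lemma prob_degrees_not_concentrated:
  assumes G: "G = directed_grg \<or> G = undirected_grg" and eps: "0 < \<epsilon>" "\<epsilon> \<le> 2"
  shows "measure_pmf.prob (G d n) {E. \<not> degrees_concentrated \<epsilon> d n E}
    \<le> 128 / \<epsilon>^4 * (\<Sum>v\<in>V n. 1 / (d n v)\<^sup>2)"
proof -
  let ?M = "d_max d n" and ?P = "measure_pmf.prob (G d n)"
  let ?dev = "\<lambda>a v. {E. \<epsilon> * d n v \<le> \<bar>(\<Sum>u\<in>V n. a u * of_bool ((u, v) \<in> E)) - (\<Sum>u\<in>V n. a u * link_prob d n v u)\<bar>}"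
  \<comment> \<open>Weights 1 control the degree, and weights \<open>d n u / ?M\<close> the
    neighbourhood sum of expected degrees. Each node thus costs two tail bounds, whence 128 = 2 *
    64.\<close>
  let ?bad = "\<lambda>v. ?dev (\<lambda>_. 1) v \<union> ?dev (\<lambda>u. d n u / ?M) v"
  have "E \<in> (\<Union>v\<in>V n. ?bad v)" if E: "E \<in> set_pmf (G d n)" "\<not> degrees_concentrated \<epsilon> d n E" for E
  proof -
    have N: "nbrs E v \<subseteq> V n" for v by (rule nbrs_subset_V[OF G E(1)])
    obtain v where v: "v \<in> V n" and dev: "\<epsilon> * d n v \<le> \<bar>real (deg E v) - d n v\<bar> \<or>
        \<epsilon> * ?M * d n v \<le> \<bar>(\<Sum>u\<in>nbrs E v. d n u) - d n v * mean_nbr_degree d n\<bar>"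
      using E(2) N unfolding degrees_concentrated_def by (auto simp: not_less)
    have "real (deg E v) = (\<Sum>u\<in>V n. 1 * of_bool ((u, v) \<in> E))"
      using sum_nbrs_eq[OF N, of "\<lambda>_. 1"] unfolding deg_def by simp
    moreover have "(\<Sum>u\<in>V n. d n u / ?M * of_bool ((u, v) \<in> E))
          - (\<Sum>u\<in>V n. d n u / ?M * link_prob d n v u)
        = ((\<Sum>u\<in>nbrs E v. d n u) - d n v * mean_nbr_degree d n) / ?M"
      unfolding sum_degree_link_prob[symmetric] sum_nbrs_eq[OF N]
      by (simp add: sum_divide_distrib diff_divide_distrib)
    ultimately have "E \<in> ?bad v" using dev d_max_pos
      by (auto simp: sum_link_prob abs_divide pos_le_divide_eq mult_ac simp del: mult_1)
    with v show ?thesis by blast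
  qed
  hence "?P {E. \<not> degrees_concentrated \<epsilon> d n E} \<le> ?P (\<Union>v\<in>V n. ?bad v)"
    by (intro measure_pmf.finite_measure_mono_AE) (auto simp: AE_measure_pmf_iff)
  also have "\<dots> \<le> (\<Sum>v\<in>V n. ?P (?bad v))"
    by (rule measure_pmf.finite_measure_subadditive_finite) (auto simp: finite_V)
  also have "\<dots> \<le> (\<Sum>v\<in>V n. 64 / (\<epsilon>^4 * (d n v)\<^sup>2) + 64 / (\<epsilon>^4 * (d n v)\<^sup>2))"
  proof (rule sum_mono)
    fix v assume v: "v \<in> V n"
    have "?P (?bad v) \<le> ?P (?dev (\<lambda>_. 1) v) + ?P (?dev (\<lambda>u. d n u / ?M) v)"
      by (rule measure_subadditive) (auto simp: measure_pmf.emeasure_eq_measure)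
    also have "\<dots> \<le> 64 / (\<epsilon>^4 * (d n v)\<^sup>2) + 64 / (\<epsilon>^4 * (d n v)\<^sup>2)"
    proof (intro add_mono column_concentration[OF G v _ eps])
      show "\<bar>d n u / ?M\<bar> \<le> 1" if "u \<in> V n" for u
        using d_pos[OF that] le_d_max[OF that] d_max_pos by (simp add: field_simps)
    qed auto
    finally show "?P (?bad v) \<le> 64 / (\<epsilon>^4 * (d n v)\<^sup>2) + 64 / (\<epsilon>^4 * (d n v)\<^sup>2)" .
  qed
  also have "\<dots> = 128 / \<epsilon>^4 * (\<Sum>v\<in>V n. 1 / (d n v)\<^sup>2)"
    by (simp add: sum_distrib_left)
  finally show ?thesis .
qed

section \<open>Initial averages and \<open>phi\<close> on a fixed graph with concentrated
  degrees\<close>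

context
  fixes \<epsilon> c :: real and E :: "(nat \<times> nat) set"
  assumes eps: "0 < \<epsilon>" "\<epsilon> \<le> 1/4"
    and conc: "degrees_concentrated \<epsilon> d n E"
    and c_pos: "0 < c" and c_le: "\<And>v. v \<in> V n \<Longrightarrow> c * real (deg E v) \<le> 1"
begin

lemma deg_near: "v \<in> V n \<Longrightarrow> \<bar>real (deg E v) - d n v\<bar> \<le> \<epsilon> * d n v"
  using conc unfolding degrees_concentrated_def by (auto simp: less_imp_le)

lemma deg_bounds:
  assumes "v \<in> V n"
  shows "3/4 * d n v \<le> real (deg E v)" "real (deg E v) \<le> 5/4 * d n v"
proof -
  have "\<epsilon> * d n v \<le> 1/4 * d n v" using eps d_pos[OF assms] by (intro mult_right_mono) auto
  thus "3/4 * d n v \<le> real (deg E v)" "real (deg E v) \<le> 5/4 * d n v"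
    using deg_near[OF assms] by linarith+
qed

lemma deg_pos: "v \<in> V n \<Longrightarrow> 0 < deg E v"
  using deg_bounds(1)[of v] d_pos[of v] by (cases "deg E v") auto

text \<open>Since the initial probabilities are at most \<open>1\<close>, the proportionality factor is at most of
  the order \<open>1 / d_max\<close>; this turns the concentration of the weighted neighbourhood sums at
  scale \<open>d_max\<close> into one at scale \<open>1\<close>.\<close>

lemma factor_d_max_le: "c * d_max d n \<le> 4/3"
proof -
  obtain v where v: "v \<in> V n" "d n v = d_max d n" using d_max_attained by blast
  have "c * (3/4 * d_max d n) \<le> c * real (deg E v)"
    using deg_bounds(1)[OF v(1)] v(2) c_pos by (intro mult_left_mono) auto
  thus ?thesis using c_le[OF v(1)] by simp
qed

lemma factor_mean_bounds: "0 \<le> c * mean_nbr_degree d n" "c * mean_nbr_degree d n \<le> 4/3"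
proof -
  show "0 \<le> c * mean_nbr_degree d n" using mean_nbr_degree_bounds c_pos by simp
  have "c * mean_nbr_degree d n \<le> c * d_max d n" using mean_nbr_degree_bounds c_pos by simp
  with factor_d_max_le show "c * mean_nbr_degree d n \<le> 4/3" by linarith
qed

text \<open>Two replacements in the neighbourhood sum: actual by expected degrees costs \<epsilon>
  \<open>* X\<close> with \<open>X \<le> 5/4 * ?M * d n v\<close>, and \<open>X\<close> by its mean
  costs \<epsilon> \<open>* ?M * d n v\<close>. Together 9/4; times \<open>c * ?M \<le> 4/3\<close>
  this is the constant 3 of \<open>quotient_near\<close>.\<close>

lemma nbr_average_near:
  assumes v: "v \<in> V n"
  shows "\<bar>(1 / real (deg E v)) * (\<Sum>u\<in>nbrs E v. c * real (deg E u)) - c * mean_nbr_degree d n\<bar> \<le> 6 * \<epsilon>"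
proof -
  let ?m = "mean_nbr_degree d n" and ?M = "d_max d n"
  define X where "X = (\<Sum>u\<in>nbrs E v. d n u)"
  define N where "N = (\<Sum>u\<in>nbrs E v. real (deg E u))"
  have nb: "nbrs E v \<subseteq> V n" and X: "\<bar>X - d n v * ?m\<bar> \<le> \<epsilon> * ?M * d n v"
    using conc v unfolding degrees_concentrated_def X_def by (auto simp: less_imp_le)
  have "\<bar>N - X\<bar> \<le> (\<Sum>u\<in>nbrs E v. \<bar>real (deg E u) - d n u\<bar>)"
    unfolding N_def X_def sum_subtractf[symmetric] by (rule sum_abs)
  also have "\<dots> \<le> (\<Sum>u\<in>nbrs E v. \<epsilon> * d n u)" using nb deg_near by (intro sum_mono) auto
  finally have NX: "\<bar>N - X\<bar> \<le> \<epsilon> * X" unfolding X_def by (simp add: sum_distrib_left)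
  have "\<epsilon> * ?M * d n v \<le> 1/4 * ?M * d n v"
    using eps d_max_pos d_pos[OF v] by (intro mult_right_mono) auto
  moreover have "d n v * ?m \<le> d n v * ?M" using mean_nbr_degree_bounds d_pos[OF v] by simp
  ultimately have "X \<le> 5/4 * ?M * d n v" using X by (simp only: mult_ac)
  hence "\<epsilon> * X \<le> \<epsilon> * (5/4 * ?M * d n v)" using eps by simp
  hence "\<bar>N - d n v * ?m\<bar> \<le> 9/4 * \<epsilon> * ?M * d n v" using NX X by linarith
  hence "c * \<bar>N - d n v * ?m\<bar> \<le> c * (9/4 * \<epsilon> * ?M * d n v)" using c_pos by simp
  also have "\<dots> = 9/4 * \<epsilon> * d n v * (c * ?M)" by simp
  also have "\<dots> \<le> 9/4 * \<epsilon> * d n v * (4/3)"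
    using factor_d_max_le eps d_pos[OF v] by (intro mult_left_mono) auto
  also have "c * \<bar>N - d n v * ?m\<bar> = \<bar>c * (N - d n v * ?m)\<bar>"
    using c_pos by (simp add: abs_mult)
  also have "c * (N - d n v * ?m) = c * N - c * ?m * d n v"
    by (simp add: right_diff_distrib)
  finally have "\<bar>c * N / real (deg E v) - c * ?m\<bar> \<le> 6 * \<epsilon>"
    using deg_near[OF v]
    by (intro quotient_near[OF eps d_pos[OF v] factor_mean_bounds]) auto
  thus ?thesis unfolding N_def by (simp add: sum_distrib_left sum_divide_distrib)
qed

lemma sum_deg_near: "\<bar>(\<Sum>v\<in>V n. real (deg E v)) - (\<Sum>v\<in>V n. d n v)\<bar> \<le> \<epsilon> * (\<Sum>v\<in>V n. d n v)"
proof -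
  have "\<bar>(\<Sum>v\<in>V n. real (deg E v)) - (\<Sum>v\<in>V n. d n v)\<bar> \<le> (\<Sum>v\<in>V n. \<bar>real (deg E v) - d n v\<bar>)"
    unfolding sum_subtractf[symmetric] by (rule sum_abs)
  also have "\<dots> \<le> (\<Sum>v\<in>V n. \<epsilon> * d n v)" using deg_near by (intro sum_mono) auto
  finally show ?thesis by (simp add: sum_distrib_left)
qed

text \<open>The quotient is the conditional expectation of \<open>phi\<close> given the graph, so
  \<open>phi\<close> and the neighbourhood averages share one centre. The factor 9/4 comes from
  \<open>x^2 - y^2 = (x - y) * (x + y)\<close> with the actual degree at most 5/4 of the expected
  one.\<close>

lemma mean_phi_near:
  "\<bar>(\<Sum>v\<in>V n. c * (real (deg E v))\<^sup>2) / (\<Sum>v\<in>V n. real (deg E v)) - c * mean_nbr_degree d n\<bar> \<le> 6 * \<epsilon>"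
proof (rule quotient_near[OF eps sum_d_pos factor_mean_bounds _ sum_deg_near])
  let ?m = "mean_nbr_degree d n" and ?D = "\<Sum>v\<in>V n. d n v"
  have mD: "?m * ?D = (\<Sum>v\<in>V n. (d n v)\<^sup>2)"
    using sum_d_pos unfolding mean_nbr_degree_def by simp
  have "\<bar>(real (deg E v))\<^sup>2 - (d n v)\<^sup>2\<bar> \<le> 9/4 * \<epsilon> * (d n v)\<^sup>2" if v: "v \<in> V n" for v
  proof -
    have "\<bar>(real (deg E v))\<^sup>2 - (d n v)\<^sup>2\<bar> = \<bar>real (deg E v) - d n v\<bar> * (real (deg E v) + d n v)"
      using d_pos[OF v] by (simp add: power2_eq_square square_diff_square_factored abs_mult mult.commute)
    also have "\<dots> \<le> (\<epsilon> * d n v) * (9/4 * d n v)"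
      using deg_near[OF v] deg_bounds(2)[OF v] eps d_pos[OF v] by (intro mult_mono) auto
    finally show ?thesis by (simp add: power2_eq_square mult_ac)
  qed
  hence sq: "(\<Sum>v\<in>V n. \<bar>(real (deg E v))\<^sup>2 - (d n v)\<^sup>2\<bar>) \<le> (\<Sum>v\<in>V n. 9/4 * \<epsilon> * (d n v)\<^sup>2)"
    by (rule sum_mono)
  have "\<bar>(\<Sum>v\<in>V n. (real (deg E v))\<^sup>2) - (\<Sum>v\<in>V n. (d n v)\<^sup>2)\<bar> \<le> 9/4 * \<epsilon> * (\<Sum>v\<in>V n. (d n v)\<^sup>2)"
    unfolding sum_subtractf[symmetric] sum_distrib_left by (rule order_trans[OF sum_abs sq])
  hence "\<bar>(\<Sum>v\<in>V n. (real (deg E v))\<^sup>2) - ?m * ?D\<bar> \<le> 9/4 * \<epsilon> * (?m * ?D)"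
    by (simp only: mD)
  hence "c * \<bar>(\<Sum>v\<in>V n. (real (deg E v))\<^sup>2) - ?m * ?D\<bar> \<le> c * (9/4 * \<epsilon> * (?m * ?D))"
    using c_pos by simp
  also have "\<dots> = 9/4 * \<epsilon> * ?D * (c * ?m)" by simp
  also have "\<dots> \<le> 9/4 * \<epsilon> * ?D * (4/3)"
    using factor_mean_bounds(2) eps sum_d_pos by (intro mult_left_mono) auto
  also have "c * \<bar>(\<Sum>v\<in>V n. (real (deg E v))\<^sup>2) - ?m * ?D\<bar>
      = \<bar>c * ((\<Sum>v\<in>V n. (real (deg E v))\<^sup>2) - ?m * ?D)\<bar>"
    using c_pos by (simp add: abs_mult)
  also have "c * ((\<Sum>v\<in>V n. (real (deg E v))\<^sup>2) - ?m * ?D)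
      = (\<Sum>v\<in>V n. c * (real (deg E v))\<^sup>2) - c * ?m * ?D"
    by (simp only: right_diff_distrib sum_distrib_left mult.assoc)
  finally show "\<bar>(\<Sum>v\<in>V n. c * (real (deg E v))\<^sup>2) - c * ?m * ?D\<bar> \<le> 3 * \<epsilon> * ?D" by simp
qed

lemma phi_concentration:
  "measure_pmf.prob (Pi_pmf (V n) False (\<lambda>v. bernoulli_pmf (c * real (deg E v))))
     {X. \<epsilon> \<le> \<bar>phi n E {v \<in> V n. X v} - (\<Sum>v\<in>V n. c * (real (deg E v))\<^sup>2) / (\<Sum>v\<in>V n. real (deg E v))\<bar>}
   \<le> 1024 / \<epsilon>^4 * (\<Sum>v\<in>V n. 1 / (d n v)\<^sup>2)"
proof -
  let ?M = "d_max d n" and ?D = "\<Sum>v\<in>V n. d n v"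
  let ?L = "\<Sum>v\<in>V n. real (deg E v)"
  \<comment> \<open>The weights \<open>a\<close> are at most 1 because actual degrees are at most
    \<open>5/4 * ?M\<close>. They sum to \<open>T\<close>, so \<open>T\<close> bounds the variance
    proxy and \<open>phi\<close> equals the weighted coin sum divided by \<open>T\<close>.\<close>
  define T where "T = ?L / (2 * ?M)"
  define a where "a = (\<lambda>v. real (deg E v) / (2 * ?M))"
  have "\<epsilon> * ?D \<le> 1/4 * ?D" using eps sum_d_pos by (intro mult_right_mono) auto
  hence "3/4 * ?D \<le> ?L" using sum_deg_near by linarith
  \<comment> \<open>Here \<open>d_max_le\<close> enters: it makes the total degree at least of order
    \<open>?M^2\<close>, hence \<open>T\<close> at least of order \<open>?M\<close>.\<close>
  hence L: "1/2 * ?M\<^sup>2 \<le> ?L" using d_max_le sum_d_pos by linarith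
  have L0: "0 < ?L" using L zero_less_power[OF d_max_pos, of 2] by linarith
  have T: "?M / 4 \<le> T" using L d_max_pos unfolding T_def
    by (simp add: pos_le_divide_eq power2_eq_square)
  have T0: "0 < T" using T d_max_pos by linarith
  have a1: "0 \<le> a v \<and> a v \<le> 1" if "v \<in> V n" for v
  proof -
    have "real (deg E v) \<le> 2 * ?M"
      using deg_bounds(2)[OF that] le_d_max[OF that] d_pos[OF that] by linarith
    thus ?thesis using d_max_pos unfolding a_def by simp
  qed
  have "(\<Sum>v\<in>V n. (a v)\<^sup>2 * (c * real (deg E v))) \<le> (\<Sum>v\<in>V n. a v)"
  proof (rule sum_mono)
    fix v assume v: "v \<in> V n"
    have "(a v)\<^sup>2 * (c * real (deg E v)) \<le> (a v)\<^sup>2 * 1"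
      using c_le[OF v] by (intro mult_left_mono) auto
    also have "\<dots> \<le> a v * 1" using a1[OF v] unfolding power2_eq_square mult_1_right
      by (intro mult_left_le) auto
    finally show "(a v)\<^sup>2 * (c * real (deg E v)) \<le> a v" by simp
  qed
  also have "\<dots> = T" unfolding a_def T_def by (simp add: sum_divide_distrib)
  finally have var: "(\<Sum>v\<in>V n. (a v)\<^sup>2 * (c * real (deg E v))) \<le> T" .
  have "phi n E {v \<in> V n. X v} = (\<Sum>v\<in>V n. a v * of_bool (X v)) / T" for X
  proof -
    have "(\<Sum>v\<in>{v \<in> V n. X v}. real (deg E v)) = (\<Sum>v\<in>V n. real (deg E v) * of_bool (X v))"
      unfolding sum.inter_filter[OF finite_V] by (intro sum.cong) auto
    moreover have "(\<Sum>v\<in>V n. a v * of_bool (X v)) = (\<Sum>v\<in>V n. real (deg E v) * of_bool (X v)) / (2 * ?M)"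
      by (simp only: a_def sum_divide_distrib times_divide_eq_left)
    ultimately show ?thesis using d_max_pos by (simp only: phi_def T_def of_nat_sum) simp
  qed
  moreover have "(\<Sum>v\<in>V n. c * (real (deg E v))\<^sup>2) / ?L = (\<Sum>v\<in>V n. a v * (c * real (deg E v))) / T"
  proof -
    have "(\<Sum>v\<in>V n. a v * (c * real (deg E v))) = (\<Sum>v\<in>V n. c * (real (deg E v))\<^sup>2) / (2 * ?M)"
      unfolding a_def sum_divide_distrib by (intro sum.cong) (auto simp: power2_eq_square)
    thus ?thesis using d_max_pos by (simp only: T_def) simp
  qed
  ultimately have tail: "{X. \<epsilon> \<le> \<bar>phi n E {v \<in> V n. X v} - (\<Sum>v\<in>V n. c * (real (deg E v))\<^sup>2) / ?L\<bar>}
      = {X. \<epsilon> * T \<le> \<bar>(\<Sum>v\<in>V n. a v * of_bool (X v)) - (\<Sum>v\<in>V n. a v * (c * real (deg E v)))\<bar>}"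
    using T0 by (simp only: diff_divide_distrib[symmetric] abs_divide) (simp add: pos_le_divide_eq)
  have "measure_pmf.prob (Pi_pmf (V n) False (\<lambda>v. bernoulli_pmf (c * real (deg E v))))
      {X. \<epsilon> * T \<le> \<bar>(\<Sum>v\<in>V n. a v * of_bool (X v)) - (\<Sum>v\<in>V n. a v * (c * real (deg E v)))\<bar>}
      \<le> 64 / (\<epsilon>^4 * T\<^sup>2)"
    using c_pos c_le a1 var T0 eps
    by (intro weighted_bernoulli_concentration finite_V) auto
  also have "64 / (\<epsilon>^4 * T\<^sup>2) \<le> 64 / (\<epsilon>^4 * (?M / 4)\<^sup>2)"
    using T d_max_pos eps T0 by (intro divide_left_mono mult_left_mono power_mono mult_pos_pos) auto
  also have "\<dots> = 1024 / \<epsilon>^4 * (1 / ?M\<^sup>2)" by (simp add: power_divide)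
  \<comment> \<open>\<open>1 / ?M^2\<close> is itself one term of the sum, at a node of maximal
    expected degree.\<close>
  also have "\<dots> \<le> 1024 / \<epsilon>^4 * (\<Sum>v\<in>V n. 1 / (d n v)\<^sup>2)"
  proof (rule mult_left_mono)
    show "1 / ?M\<^sup>2 \<le> (\<Sum>v\<in>V n. 1 / (d n v)\<^sup>2)"
    proof -
      obtain v where "v \<in> V n" "d n v = ?M" using d_max_attained by blast
      thus ?thesis using member_le_sum[of v "V n" "\<lambda>v. 1 / (d n v)\<^sup>2"] finite_V by simp
    qed
  qed (use eps in simp)
  finally show ?thesis unfolding tail .
qed

text \<open>Triangle inequality through \<open>c * mean_nbr_degree d n\<close> and the conditional
  mean of \<open>phi\<close>: 6 + 6 + 1 = 13.\<close>

lemma averages_near_phi_if: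
  assumes "\<bar>phi n E S - (\<Sum>v\<in>V n. c * (real (deg E v))\<^sup>2) / (\<Sum>v\<in>V n. real (deg E v))\<bar> < \<epsilon>"
  shows "averages_near_phi (13 * \<epsilon>) n E (\<lambda>v. c * real (deg E v)) S"
  unfolding averages_near_phi_def
proof (intro ballI conjI)
  fix v assume v: "v \<in> V n"
  show "nbrs E v \<subseteq> V n" using conc v unfolding degrees_concentrated_def by auto
  show "deg E v > 0" by (rule deg_pos[OF v])
  show "\<bar>(1 / real (deg E v)) * (\<Sum>u\<in>nbrs E v. c * real (deg E u)) - phi n E S\<bar> < 13 * \<epsilon>"
    using nbr_average_near[OF v] mean_phi_near assms by linarith
qed

end

lemma prob_averages_not_near_phi:
  assumes G: "G = directed_grg \<or> G = undirected_grg" and eps: "0 < \<epsilon>" "\<epsilon> \<le> 1/4"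
    and c_pos: "\<And>E. E \<in> set_pmf (G d n) \<Longrightarrow> 0 < c n E"
    and init_le_1: "\<And>E v. E \<in> set_pmf (G d n) \<Longrightarrow> v \<in> V n \<Longrightarrow> init_blue c n E v \<le> 1"
  shows "measure_pmf.prob (graph_blue_law (G d n) n (init_blue c n))
      {(E, S). \<not> averages_near_phi (13 * \<epsilon>) n E (init_blue c n E) S}
    \<le> 1152 / \<epsilon>^4 * (\<Sum>v\<in>V n. 1 / (d n v)\<^sup>2)" (is "measure_pmf.prob _ ?A \<le> _")
proof -
  let ?s = "\<Sum>v\<in>V n. 1 / (d n v)\<^sup>2"
  have "measure_pmf.prob (graph_blue_law (G d n) n (init_blue c n)) ?A
      \<le> measure_pmf.prob (G d n) {E. \<not> degrees_concentrated \<epsilon> d n E} + 1024 / \<epsilon>^4 * ?s"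
    unfolding graph_blue_law_def
  proof (rule prob_bind_pmf_le)
    fix E assume E: "E \<in> set_pmf (G d n)" and "E \<notin> {E. \<not> degrees_concentrated \<epsilon> d n E}"
    hence conc: "degrees_concentrated \<epsilon> d n E" by simp
    have b: "init_blue c n E = (\<lambda>v. c n E * real (deg E v))" by (auto simp: init_blue_def)
    have le: "c n E * real (deg E v) \<le> 1" if "v \<in> V n" for v
      using init_le_1[OF E that] by (simp add: b)
    let ?P = "Pi_pmf (V n) False (\<lambda>v. bernoulli_pmf (init_blue c n E v))"
    let ?far = "{X. \<epsilon> \<le> \<bar>phi n E {v \<in> V n. X v}
        - (\<Sum>v\<in>V n. c n E * (real (deg E v))\<^sup>2) / (\<Sum>v\<in>V n. real (deg E v))\<bar>}"
    have "measure_pmf.prob (map_pmf (\<lambda>X. (E, {v \<in> V n. X v})) ?P) ?A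
        = measure_pmf.prob ?P {X. \<not> averages_near_phi (13 * \<epsilon>) n E (init_blue c n E) {v \<in> V n. X v}}"
      by (simp add: vimage_def)
    also have "\<dots> \<le> measure_pmf.prob ?P ?far"
      using averages_near_phi_if[OF eps conc c_pos[OF E] le]
      by (intro measure_pmf.finite_measure_mono) (auto simp: b not_less[symmetric])
    also have "\<dots> \<le> 1024 / \<epsilon>^4 * ?s"
      unfolding b by (rule phi_concentration[OF eps conc c_pos[OF E] le])
    finally show "measure_pmf.prob (map_pmf (\<lambda>X. (E, {v \<in> V n. X v})) ?P) ?A \<le> 1024 / \<epsilon>^4 * ?s" .
  qed (use eps in \<open>auto intro!: mult_nonneg_nonneg divide_nonneg_nonneg sum_nonneg\<close>)
  also have "\<dots> \<le> 128 / \<epsilon>^4 * ?s + 1024 / \<epsilon>^4 * ?s"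
    using eps by (intro add_right_mono prob_degrees_not_concentrated[OF G]) auto
  also have "\<dots> = 1152 / \<epsilon>^4 * ?s" by (simp add: field_simps)
  finally show ?thesis .
qed

end

section \<open>Passage to the limit\<close>

text \<open>\<open>A n k\<close> will say that \<open>phi\<close> clears the threshold by a margin
  depending on \<open>k\<close>, and \<open>H n k\<close> that the averages miss \<open>phi\<close>
  by that margin. Fixing \<open>k\<close> so that \<open>F k\<close> has probability near 1 and then
  letting \<open>n\<close> grow uses only bounds for single \<open>n\<close>; the joint law across
  \<open>n\<close> stays arbitrary.\<close>

lemma (in prob_space) prob_tendsto_1_if_almost_surely_eventually:
  assumes A: "\<And>n k. n > 0 \<Longrightarrow> A n k \<in> events" and incA: "\<And>n k. A n k \<subseteq> A n (Suc k)"
    and ae: "AE \<omega> in M. \<exists>k. \<forall>n>k. \<omega> \<in> A n k"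
    and H: "\<And>n k. n > 0 \<Longrightarrow> H n k \<in> events" and H0: "\<And>k. (\<lambda>n. prob (H n k)) \<longlonglongrightarrow> 0"
    and D: "\<And>n. n > 0 \<Longrightarrow> D n \<in> events" and sub: "\<And>n k. n > 0 \<Longrightarrow> A n k - H n k \<subseteq> D n"
  shows "(\<lambda>n. prob (D n)) \<longlonglongrightarrow> 1"
proof (rule order_tendstoI)
  \<comment> \<open>One index \<open>k\<close> plays both roles, starting time and margin, which
    makes \<open>F\<close> increasing with union of full measure. Since \<open>n > k\<close>
    excludes \<open>n = 0\<close>, all sets involved are events.\<close>
  define F where "F = (\<lambda>k. \<Inter>n\<in>{k<..}. A n k)"
  have F: "F k \<in> events" for k unfolding F_def
    by (intro sets.countable_INT') (auto intro: A)
  have "incseq F"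
  proof (rule incseq_SucI)
    show "F k \<le> F (Suc k)" for k using incA unfolding F_def by fastforce
  qed
  hence "(\<lambda>k. prob (F k)) \<longlonglongrightarrow> prob (\<Union>k. F k)"
    using F by (intro finite_Lim_measure_incseq) auto
  moreover have "prob (\<Union>k. F k) = 1"
  proof (subst prob_eq_1)
    show "AE \<omega> in M. \<omega> \<in> (\<Union>k. F k)"
      using ae by (rule eventually_mono) (auto simp: F_def)
  qed (use F in auto)
  ultimately have lim: "(\<lambda>k. prob (F k)) \<longlonglongrightarrow> 1" by simp
  fix a :: real assume "a < 1"
  then obtain k where k: "(1 + a) / 2 < prob (F k)"
    using order_tendstoD(1)[OF lim, of "(1 + a) / 2"] by (auto simp: eventually_sequentially)
  have "\<forall>\<^sub>F n in sequentially. prob (H n k) < (1 - a) / 2"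
    by (rule order_tendstoD(2)[OF H0]) (use \<open>a < 1\<close> in simp)
  with eventually_gt_at_top[of k] show "\<forall>\<^sub>F n in sequentially. a < prob (D n)"
  proof eventually_elim
    case (elim n)
    hence n: "n > 0" by simp
    have "F k \<subseteq> D n \<union> H n k" using sub[OF n] elim(1) unfolding F_def by blast
    hence "prob (F k) \<le> prob (D n \<union> H n k)" using D H n by (intro finite_measure_mono) auto
    also have "\<dots> \<le> prob (D n) + prob (H n k)"
      using D H n by (intro measure_subadditive) auto
    finally show ?case using elim(2) k by (simp add: field_simps)
  qed
next
  fix a :: real assume "1 < a"
  hence "prob (D n) < a" for n using prob_le_1[of "D n"] by linarith
  thus "\<forall>\<^sub>F n in sequentially. prob (D n) < a" by simp
qed

context prob_space
begin

context
  fixes d :: "nat \<Rightarrow> nat \<Rightarrow> real"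
    and grg :: "(nat \<Rightarrow> nat \<Rightarrow> real) \<Rightarrow> nat \<Rightarrow> (nat \<times> nat) set pmf"
    and c :: "nat \<Rightarrow> (nat \<times> nat) set \<Rightarrow> real"
    and G :: "nat \<Rightarrow> 'a \<Rightarrow> (nat \<times> nat) set"
    and S :: "nat \<Rightarrow> 'a \<Rightarrow> nat set"
  assumes d_pos: "\<And>n v. v \<in> V n \<Longrightarrow> 0 < d n v"
    and d_max_le: "\<And>n. n \<ge> 1 \<Longrightarrow> (d_max d n)\<^sup>2 \<le> (\<Sum>k\<in>V n. d n k)"
    and grg: "grg = directed_grg \<or> grg = undirected_grg"
    and c_pos: "\<And>n E. n \<ge> 1 \<Longrightarrow> E \<in> set_pmf (grg d n) \<Longrightarrow> 0 < c n E"
    and init_le_1: "\<And>n E v. n \<ge> 1 \<Longrightarrow> E \<in> set_pmf (grg d n) \<Longrightarrow> v \<in> V n \<Longrightarrow> init_blue c n E v \<le> 1"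
    and GS_measurable: "\<And>n. n \<ge> 1 \<Longrightarrow> (\<lambda>\<omega>. (G n \<omega>, S n \<omega>)) \<in> measurable M (count_space UNIV)"
    and GS_law: "\<And>n. n \<ge> 1 \<Longrightarrow> distr M (count_space UNIV) (\<lambda>\<omega>. (G n \<omega>, S n \<omega>))
                   = measure_pmf (graph_blue_law (grg d n) n (init_blue c n))"
    and sum_inverse_squares: "(\<lambda>n. \<Sum>v\<in>V n. 1 / (d n v)\<^sup>2) \<longlonglongrightarrow> 0"
begin

text \<open>Every set of pairs is measurable in \<open>count_space UNIV\<close>, so even conditions
  quantifying over all solutions of the dynamics define events.\<close>

lemma GS_event: "n > 0 \<Longrightarrow> {\<omega> \<in> space M. R (G n \<omega>) (S n \<omega>)} \<in> events"
  using measurable_sets[OF GS_measurable[of n], of "{(E, S). R E S}"]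
  by (simp add: vimage_def Int_def conj_commute)

lemma prob_GS:
  assumes "n > 0"
  shows "prob {\<omega> \<in> space M. R (G n \<omega>) (S n \<omega>)}
    = measure_pmf.prob (graph_blue_law (grg d n) n (init_blue c n)) {(E, S). R E S}"
proof -
  have n: "n \<ge> 1" using assms by simp
  show ?thesis unfolding GS_law[OF n, symmetric]
    by (subst measure_distr[OF GS_measurable[OF n]]) (auto simp: vimage_def Int_def conj_commute)
qed

lemma prob_averages_far_tendsto_0:
  assumes "\<delta> > 0"
  shows "(\<lambda>n. prob {\<omega> \<in> space M. \<not> averages_near_phi \<delta> n (G n \<omega>) (init_blue c n (G n \<omega>)) (S n \<omega>)}) \<longlonglongrightarrow> 0"
proof -
  define \<epsilon> where "\<epsilon> = min (\<delta> / 13) (1 / 4)"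
  have eps: "0 < \<epsilon>" "\<epsilon> \<le> 1/4" "13 * \<epsilon> \<le> \<delta>" using assms unfolding \<epsilon>_def by auto
  have "(\<lambda>n. 1152 / \<epsilon>^4 * (\<Sum>v\<in>V n. 1 / (d n v)\<^sup>2)) \<longlonglongrightarrow> 1152 / \<epsilon>^4 * 0"
    by (intro tendsto_intros sum_inverse_squares)
  hence lim: "(\<lambda>n. 1152 / \<epsilon>^4 * (\<Sum>v\<in>V n. 1 / (d n v)\<^sup>2)) \<longlonglongrightarrow> 0" by simp
  show ?thesis
  proof (rule tendsto_sandwich[OF _ _ tendsto_const lim])
    show "\<forall>\<^sub>F n in sequentially.
        prob {\<omega> \<in> space M. \<not> averages_near_phi \<delta> n (G n \<omega>) (init_blue c n (G n \<omega>)) (S n \<omega>)}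
          \<le> 1152 / \<epsilon>^4 * (\<Sum>v\<in>V n. 1 / (d n v)\<^sup>2)"
      using eventually_gt_at_top[of 0]
    proof eventually_elim
      case (elim n)
      hence n: "n \<ge> 1" by simp
      have "prob {\<omega> \<in> space M. \<not> averages_near_phi \<delta> n (G n \<omega>) (init_blue c n (G n \<omega>)) (S n \<omega>)}
          \<le> measure_pmf.prob (graph_blue_law (grg d n) n (init_blue c n))
              {(E, S). \<not> averages_near_phi (13 * \<epsilon>) n E (init_blue c n E) S}"
        using eps(3) unfolding prob_GS[OF elim, of "\<lambda>E S. \<not> averages_near_phi \<delta> n E (init_blue c n E) S"]
        by (intro measure_pmf.finite_measure_mono) (force simp: averages_near_phi_def)+
      also have "\<dots> \<le> 1152 / \<epsilon>^4 * (\<Sum>v\<in>V n. 1 / (d n v)\<^sup>2)"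
        using n d_pos d_max_le grg eps c_pos init_le_1
        by (intro prob_averages_not_near_phi) auto
      finally show ?case .
    qed
  qed simp
qed

text \<open>The margin of \<open>phi\<close> is phrased as a whole interval around
  \<open>phi\<close> lying in \<open>Q\<close>, so the same lemma serves both sides of the
  threshold; averages inside that interval are then in \<open>Q\<close>.\<close>

lemma prob_averages_inside_tendsto_1:
  assumes ae: "AE \<omega> in M. \<exists>k. \<forall>n>k. \<forall>y. \<bar>y - phi n (G n \<omega>) (S n \<omega>)\<bar> < 1 / Suc k \<longrightarrow> y \<in> Q"
    and P: "\<And>n E. (\<And>v. v \<in> V n \<Longrightarrow> nbrs E v \<subseteq> V n) \<Longrightarrow> (\<And>v. v \<in> V n \<Longrightarrow> deg E v > 0) \<Longrightarrow>
      (\<And>v. v \<in> V n \<Longrightarrow> (1 / real (deg E v)) * (\<Sum>u\<in>nbrs E v. init_blue c n E u) \<in> Q) \<Longrightarrow> P n E"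
  shows "(\<lambda>n. prob {\<omega> \<in> space M. P n (G n \<omega>)}) \<longlonglongrightarrow> 1"
proof (rule prob_tendsto_1_if_almost_surely_eventually)
  let ?A = "\<lambda>n k. {\<omega> \<in> space M. \<forall>y. \<bar>y - phi n (G n \<omega>) (S n \<omega>)\<bar> < 1 / Suc k \<longrightarrow> y \<in> Q}"
  let ?H = "\<lambda>n k. {\<omega> \<in> space M. \<not> averages_near_phi (1 / Suc k) n (G n \<omega>) (init_blue c n (G n \<omega>)) (S n \<omega>)}"
  show "?A n k \<in> events" if "n > 0" for n k using that by (rule GS_event)
  show "?A n k \<subseteq> ?A n (Suc k)" for n k
  proof -
    have "1 / real (Suc (Suc k)) \<le> 1 / real (Suc k)" by (simp add: frac_le)
    thus ?thesis by (smt (verit) Collect_mono_iff)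
  qed
  show "AE \<omega> in M. \<exists>k. \<forall>n>k. \<omega> \<in> ?A n k" using ae by (auto elim: AE_mp)
  show "?H n k \<in> events" if "n > 0" for n k using that by (rule GS_event)
  show "(\<lambda>n. prob (?H n k)) \<longlonglongrightarrow> 0" for k by (rule prob_averages_far_tendsto_0) simp
  show "{\<omega> \<in> space M. P n (G n \<omega>)} \<in> events" if "n > 0" for n
    using GS_event[OF that, of "\<lambda>E _. P n E"] .
  show "?A n k - ?H n k \<subseteq> {\<omega> \<in> space M. P n (G n \<omega>)}" for n k
    by (auto intro!: P simp: averages_near_phi_def)
qed

end

end

theorem theorem4:
  fixes M :: "'w measure"
    and d :: "nat \<Rightarrow> nat \<Rightarrow> real"
    and grg :: "(nat \<Rightarrow> nat \<Rightarrow> real) \<Rightarrow> nat \<Rightarrow> (nat \<times> nat) set pmf"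
    and c :: "nat \<Rightarrow> (nat \<times> nat) set \<Rightarrow> real"
    and G :: "nat \<Rightarrow> 'w \<Rightarrow> (nat \<times> nat) set"
    and S :: "nat \<Rightarrow> 'w \<Rightarrow> nat set"
    and \<sigma> :: real
  assumes "prob_space M"
    and "0 < \<sigma>" and "\<sigma> < 1"
    and d_pos: "\<And>n v. v \<in> V n \<Longrightarrow> 0 < d n v"
    and d_max_le: "\<And>n. n \<ge> 1 \<Longrightarrow> (d_max d n)^2 \<le> (\<Sum>k\<in>V n. d n k)"
    and grg: "grg = directed_grg \<or> grg = undirected_grg"
    and c_pos: "\<And>n E. n \<ge> 1 \<Longrightarrow> E \<in> set_pmf (grg d n) \<Longrightarrow> 0 < c n E"
    and init_le_1: "\<And>n E v. n \<ge> 1 \<Longrightarrow> E \<in> set_pmf (grg d n) \<Longrightarrow> v \<in> V n \<Longrightarrow> init_blue c n E v \<le> 1"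
    and GS_measurable: "\<And>n. n \<ge> 1 \<Longrightarrow> (\<lambda>\<omega>. (G n \<omega>, S n \<omega>)) \<in> measurable M (count_space UNIV)"
    and GS_law: "\<And>n. n \<ge> 1 \<Longrightarrow> distr M (count_space UNIV) (\<lambda>\<omega>. (G n \<omega>, S n \<omega>))
                   = measure_pmf (graph_blue_law (grg d n) n (init_blue c n))"
    and i: "AE \<omega> in M. (\<lambda>n. SUP v\<in>V n. q d n (init_blue c n (G n \<omega>)) v
                                / (s d n (init_blue c n (G n \<omega>)) v)^3) \<longlonglongrightarrow> 0"
    and ii: "(\<lambda>n. SUP v\<in>V n. g d n v / (w d n v)^3) \<longlonglongrightarrow> 0"
    and iii: "(\<lambda>n. sqrt (ln (real n)) / d_min d n) \<longlonglongrightarrow> 0"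
    and iv: "(\<lambda>n. (\<Sum>v\<in>V n. g d n v) / (\<Sum>v\<in>V n. (w d n v)^2) powr (3/2)) \<longlonglongrightarrow> 0"
    and v: "AE \<omega> in M. (\<lambda>n. (\<Sum>v\<in>V n. q d n (init_blue c n (G n \<omega>)) v)
                            / (\<Sum>v\<in>V n. (s d n (init_blue c n (G n \<omega>)) v)^2) powr (3/2)) \<longlonglongrightarrow> 0"
    and vi: "(\<lambda>n. \<Sum>v\<in>V n. 1 / (d n v)^2) \<longlonglongrightarrow> 0"
  shows
    "((AE \<omega> in M. liminf (\<lambda>n. ereal (phi n (G n \<omega>) (S n \<omega>))) > ereal \<sigma>) \<longrightarrow>
        (\<lambda>n. measure M {\<omega> \<in> space M.
           (\<exists>B. type1_solution \<sigma> n (G n \<omega>) (init_blue c n (G n \<omega>)) B) \<and>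
           (\<forall>B. type1_solution \<sigma> n (G n \<omega>) (init_blue c n (G n \<omega>)) B \<longrightarrow>
                (\<forall>v\<in>V n. (B v \<longlongrightarrow> 1) at_top))}) \<longlonglongrightarrow> 1) \<and>
     ((AE \<omega> in M. limsup (\<lambda>n. ereal (phi n (G n \<omega>) (S n \<omega>))) < ereal \<sigma>) \<longrightarrow>
        (\<lambda>n. measure M {\<omega> \<in> space M.
           (\<exists>B. type1_solution \<sigma> n (G n \<omega>) (init_blue c n (G n \<omega>)) B) \<and>
           (\<forall>B. type1_solution \<sigma> n (G n \<omega>) (init_blue c n (G n \<omega>)) B \<longrightarrow>
                (\<forall>v\<in>V n. ((\<lambda>t. 1 - B v t) \<longlongrightarrow> 1) at_top))}) \<longlonglongrightarrow> 1)"
proof -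
  interpret prob_space M by fact
  note tendsto_1 = prob_averages_inside_tendsto_1[OF d_pos d_max_le grg c_pos init_le_1 GS_measurable GS_law vi]
  show ?thesis
  proof (intro conjI impI)
    assume ae: "AE \<omega> in M. liminf (\<lambda>n. ereal (phi n (G n \<omega>) (S n \<omega>))) > ereal \<sigma>"
    show "(\<lambda>n. measure M {\<omega> \<in> space M.
           (\<exists>B. type1_solution \<sigma> n (G n \<omega>) (init_blue c n (G n \<omega>)) B) \<and>
           (\<forall>B. type1_solution \<sigma> n (G n \<omega>) (init_blue c n (G n \<omega>)) B \<longrightarrow>
                (\<forall>v\<in>V n. (B v \<longlongrightarrow> 1) at_top))}) \<longlonglongrightarrow> 1"
    proof (rule tendsto_1[where Q = "{\<sigma><..}"])
      show "AE \<omega> in M. \<exists>k. \<forall>n>k. \<forall>y. \<bar>y - phi n (G n \<omega>) (S n \<omega>)\<bar> < 1 / Suc k \<longrightarrow> y \<in> {\<sigma><..}"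
        using ae
      proof eventually_elim
        case (elim \<omega>)
        then obtain r where r: "\<sigma> < r" "ereal r < liminf (\<lambda>n. ereal (phi n (G n \<omega>) (S n \<omega>)))"
          using ereal_dense2[OF elim] by auto
        from less_LiminfD[OF r(2)] obtain N where N: "\<And>n. n \<ge> N \<Longrightarrow> r < phi n (G n \<omega>) (S n \<omega>)"
          by (auto simp: eventually_sequentially)
        obtain k where k: "1 / Suc k < r - \<sigma>" using nat_approx_posE[of "r - \<sigma>"] r by auto
        \<comment> \<open>\<open>max N k\<close> must serve at once as a time beyond
          \<open>N\<close> and as an index whose margin is below \<open>r - \<sigma>\<close>;
          enlarging \<open>k\<close> only shrinks the margin.\<close>
        have le: "1 / Suc (max N k) \<le> 1 / Suc k" by (intro divide_left_mono) auto
        show ?case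
        proof (intro exI[of _ "max N k"] allI impI)
          fix n y assume "n > max N k" "\<bar>y - phi n (G n \<omega>) (S n \<omega>)\<bar> < 1 / Suc (max N k)"
          thus "y \<in> {\<sigma><..}" using N[of n] k le by auto
        qed
      qed
    next
      fix n E
      assume *: "\<And>v. v \<in> V n \<Longrightarrow> nbrs E v \<subseteq> V n" "\<And>v. v \<in> V n \<Longrightarrow> deg E v > 0"
        "\<And>v. v \<in> V n \<Longrightarrow> (1 / real (deg E v)) * (\<Sum>u\<in>nbrs E v. init_blue c n E u) \<in> {\<sigma><..}"
      show "(\<exists>B. type1_solution \<sigma> n E (init_blue c n E) B) \<and>
           (\<forall>B. type1_solution \<sigma> n E (init_blue c n E) B \<longrightarrow> (\<forall>v\<in>V n. (B v \<longlongrightarrow> 1) at_top))"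
      proof (rule all_solutions_converge[where Q = "{\<sigma><..}", OF _ _ _ *])
        fix x \<theta> :: real assume x: "x \<in> {\<sigma><..}" and \<theta>: "0 < \<theta>" "\<theta> \<le> 1"
        have "\<sigma> * \<theta> < x * \<theta>" using x \<theta> by simp
        \<comment> \<open>\<open>1 + (x - 1) * \<theta>\<close> is the convex combination of
          \<open>x\<close> and 1; both lie above \<sigma>, the latter by \<sigma> < 1. In the other
          case 0 < \<sigma> plays this role.\<close>
        moreover have "\<sigma> * (1 - \<theta>) \<le> 1 * (1 - \<theta>)" using \<open>\<sigma> < 1\<close> \<theta> by (intro mult_right_mono) auto
        ultimately show "1 + (x - 1) * \<theta> \<in> {\<sigma><..}" by (simp add: algebra_simps)
      qed (auto simp: threshold_def)
    qed
  next
    assume ae: "AE \<omega> in M. limsup (\<lambda>n. ereal (phi n (G n \<omega>) (S n \<omega>))) < ereal \<sigma>"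
    show "(\<lambda>n. measure M {\<omega> \<in> space M.
           (\<exists>B. type1_solution \<sigma> n (G n \<omega>) (init_blue c n (G n \<omega>)) B) \<and>
           (\<forall>B. type1_solution \<sigma> n (G n \<omega>) (init_blue c n (G n \<omega>)) B \<longrightarrow>
                (\<forall>v\<in>V n. ((\<lambda>t. 1 - B v t) \<longlongrightarrow> 1) at_top))}) \<longlonglongrightarrow> 1"
    proof (rule tendsto_1[where Q = "{..<\<sigma>}"])
      show "AE \<omega> in M. \<exists>k. \<forall>n>k. \<forall>y. \<bar>y - phi n (G n \<omega>) (S n \<omega>)\<bar> < 1 / Suc k \<longrightarrow> y \<in> {..<\<sigma>}"
        using ae
      proof eventually_elim
        case (elim \<omega>)
        then obtain r where r: "r < \<sigma>" "limsup (\<lambda>n. ereal (phi n (G n \<omega>) (S n \<omega>))) < ereal r"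
          using ereal_dense2[OF elim] by auto
        from Limsup_lessD[OF r(2)] obtain N where N: "\<And>n. n \<ge> N \<Longrightarrow> phi n (G n \<omega>) (S n \<omega>) < r"
          by (auto simp: eventually_sequentially)
        obtain k where k: "1 / Suc k < \<sigma> - r" using nat_approx_posE[of "\<sigma> - r"] r by auto
        have le: "1 / Suc (max N k) \<le> 1 / Suc k" by (intro divide_left_mono) auto
        show ?case
        proof (intro exI[of _ "max N k"] allI impI)
          fix n y assume "n > max N k" "\<bar>y - phi n (G n \<omega>) (S n \<omega>)\<bar> < 1 / Suc (max N k)"
          thus "y \<in> {..<\<sigma>}" using N[of n] k le by auto
        qed
      qed
    next
      fix n E
      assume *: "\<And>v. v \<in> V n \<Longrightarrow> nbrs E v \<subseteq> V n" "\<And>v. v \<in> V n \<Longrightarrow> deg E v > 0"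
        "\<And>v. v \<in> V n \<Longrightarrow> (1 / real (deg E v)) * (\<Sum>u\<in>nbrs E v. init_blue c n E u) \<in> {..<\<sigma>}"
      have "(\<exists>B. type1_solution \<sigma> n E (init_blue c n E) B) \<and>
           (\<forall>B. type1_solution \<sigma> n E (init_blue c n E) B \<longrightarrow> (\<forall>v\<in>V n. (B v \<longlongrightarrow> 0) at_top))"
      proof (rule all_solutions_converge[where Q = "{..<\<sigma>}", OF _ _ _ *])
        fix x \<theta> :: real assume x: "x \<in> {..<\<sigma>}" and \<theta>: "0 < \<theta>" "\<theta> \<le> 1"
        have "x * \<theta> < \<sigma> * \<theta>" using x \<theta> by simp
        also have "\<dots> \<le> \<sigma>" using \<open>0 < \<sigma>\<close> \<theta> by simp
        finally show "0 + (x - 0) * \<theta> \<in> {..<\<sigma>}" by simp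
      qed (auto simp: threshold_def)
      moreover have "((\<lambda>t. 1 - f t) \<longlongrightarrow> 1) at_top" if "(f \<longlongrightarrow> 0) at_top" for f :: "real \<Rightarrow> real"
        using tendsto_diff[OF tendsto_const[of 1] that] by simp
      ultimately show "(\<exists>B. type1_solution \<sigma> n E (init_blue c n E) B) \<and>
           (\<forall>B. type1_solution \<sigma> n E (init_blue c n E) B \<longrightarrow>
                (\<forall>v\<in>V n. ((\<lambda>t. 1 - B v t) \<longlongrightarrow> 1) at_top))"
        by blast
    qed
  qed
qed

end
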